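(* The only volume-preserving B-series method is the exact flow, that is, the exact solution, for which the modified vector field $\tilde f$ coincides with $f$.
   Context: Consider an autonomous ODE $y'(t)=f(y(t))$, $y(0)=y_0$, with $f\colon\mathbb R^d\to\mathbb R^d$ a smooth (Lipschitz) vector field. $\mathrm{RT}(\bullet)$ denotes the set of rooted trees with indistinguishable vertices (unlabelled rooted trees), with all edges directed towards the root; $\bullet$ also denotes the one-vertex tree; $V(\tau)$ is the vertex set of $\tau$ and $\sigma(\tau)$ the order of its symmetry group. The elementary differential $F(\tau)$ is defined by $F(\bullet)(f)=f$ and $F(\tau)(f)=f^{(k)}(F(\tau_1)(f),\dots,F(\tau_k)(f))$ if the root of $\tau$ has child subtrees $\tau_1,\dots,\tau_k$. A Butcher series (B-series) method with step $h$ is a one-step recursion $$y_{n+1}=y_n+\sum_{\tau\in\mathrm{RT}(\bullet)}\frac{h^{|V(\tau)|}}{\sigma(\tau)}\,a(\tau)\,F(\tau)(f)(y_n)$$ with coefficients $a\colon\mathrm{RT}(\bullet)\to\mathbb R$. By backward error analysis, its numerical solution is regarded as the exact solution of a modified equation $\tilde y'=\tilde f(\tilde y)$ with $$\tilde f=\sum_{\tau\in\mathrm{RT}(\bullet)}\frac{h^{|V(\tau)|-1}}{\sigma(\tau)}\,b(\tau)\,F(\tau)(f),$$ where the coefficients $b\colon\mathrm{RT}(\bullet)\to\mathbb R$ and $a$ determine each other. One considers general methods that work in arbitrary dimension $d$, for which the elementary differentials of distinct unlabelled rooted trees (respectively, of distinct directed cycles of unlabelled rooted trees) are linearly independent, so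 that $\tilde f$ is identified with the corresponding formal series of unlabelled rooted trees. A directed cycle of unlabelled rooted trees is an isomorphism class of non-empty finite connected directed graphs in which every vertex has exactly one outgoing edge (loops allowed). The divergence of an unlabelled rooted tree is the sum of all ways of closing it into a directed cycle of rooted trees by drawing an arrow from the root to a vertex. The reduced divergence is obtained from it by passing to the quotient by the span of all directed cycles of rooted trees whose cycle has length one (equivalently, one sums only over arrows from the root to non-root vertices); such cycles are discarded because one considers source-free equations, $\mathrm{div}(f)=0$. The reduced divergence is extended linearly to formal series. A B-series defines a volume-preserving method if its reduced divergence, i.e. the reduced divergence of the series $\tilde f$, is zero.
   Formalization: That the modified field equals f, i.e. that the method is the exact flow, is claimed for methods with a(•)=1 and step h≠0; for arbitrary a the modified field is a(•)f (for example a=0 gives a zero field, volume-preserving but not f). *)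

theory Defs
  imports
    Complex_Main
    "HOL-Combinatorics.Permutations"
    "Graph_Theory.Graph_Theory"
begin

section \<open>Graphs up to isomorphism\<close>

text \<open>
  All graphs are digraphs without parallel arcs (loops allowed) on a set of natural numbers.
  For such graphs an isomorphism of the library is the same as a map of the vertices.
\<close>

lemma digraph_iso_pair_iff:
  fixes G H :: "nat pair_pre_digraph"
  assumes "pair_wf_digraph G"
  shows "digraph_iso G H \<longleftrightarrow>
    (\<exists>\<phi>. inj_on \<phi> (pverts G) \<and> pverts H = \<phi> ` pverts G \<and> parcs H = map_prod \<phi> \<phi> ` parcs G)"
    (is "?L \<longleftrightarrow> ?R")
proof
  assume ?L
  then obtain f where f: "pre_digraph.digraph_isomorphism (with_proj G) f"
    and H: "with_proj H = app_iso f (with_proj G)"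
    by (auto simp: digraph_iso_def)
  have eqs: "pverts H = iso_verts f ` pverts G" "parcs H = iso_arcs f ` parcs G"
    "iso_tail f = fst" "iso_head f = snd"
    using H by (auto simp: with_proj_def app_iso_def)
  have arcs: "iso_arcs f e = map_prod (iso_verts f) (iso_verts f) e" if "e \<in> parcs G" for e
    using f that eqs(3,4) by (auto simp: pre_digraph.digraph_isomorphism_def prod_eq_iff)
  have "inj_on (iso_verts f) (pverts G)"
    using f by (auto simp: pre_digraph.digraph_isomorphism_def)
  moreover have "parcs H = map_prod (iso_verts f) (iso_verts f) ` parcs G"
    using eqs(2) arcs by (auto simp: image_iff)
  ultimately show ?R using eqs(1) by blast
next
  interpret pair_wf_digraph G by fact
  assume ?R
  then obtain \<phi> where \<phi>: "inj_on \<phi> (pverts G)" "pverts H = \<phi> ` pverts G"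
    "parcs H = map_prod \<phi> \<phi> ` parcs G" by blast
  let ?f = "\<lparr>iso_verts = \<phi>, iso_arcs = map_prod \<phi> \<phi>, iso_head = snd, iso_tail = fst\<rparr>"
  have "inj_on (map_prod \<phi> \<phi>) (parcs G)"
    using map_prod_inj_on[OF \<phi>(1) \<phi>(1)]
    by (rule inj_on_subset) (auto dest: wellformed')
  then have "pre_digraph.digraph_isomorphism (with_proj G) ?f"
    using \<phi>(1) wf_digraph_axioms by (auto simp: pre_digraph.digraph_isomorphism_def)
  moreover have "with_proj H = app_iso ?f (with_proj G)"
    using \<phi>(2,3) by (simp add: with_proj_def app_iso_def)
  ultimately show ?L unfolding digraph_iso_def by blast
qed

lemma digraph_iso_pair_refl:
  fixes G :: "nat pair_pre_digraph"
  assumes "pair_wf_digraph G"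
  shows "digraph_iso G G"
  unfolding digraph_iso_pair_iff[OF assms]
  by (intro exI[of _ id]) (auto simp: map_prod.id)

lemma digraph_iso_pair_sym:
  fixes G H :: "nat pair_pre_digraph"
  assumes "pair_wf_digraph G" "pair_wf_digraph H" "digraph_iso G H"
  shows "digraph_iso H G"
proof -
  interpret pair_wf_digraph G by fact
  obtain \<phi> where \<phi>: "inj_on \<phi> (pverts G)" "pverts H = \<phi> ` pverts G"
    "parcs H = map_prod \<phi> \<phi> ` parcs G"
    using assms(3) unfolding digraph_iso_pair_iff[OF assms(1)] by blast
  let ?\<psi> = "the_inv_into (pverts G) \<phi>"
  have inv: "?\<psi> (\<phi> x) = x" if "x \<in> pverts G" for x
    using the_inv_into_f_f[OF \<phi>(1) that] .
  have "parcs G = map_prod ?\<psi> ?\<psi> ` parcs H"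
  proof -
    have "map_prod ?\<psi> ?\<psi> ` parcs H = (\<lambda>e. map_prod ?\<psi> ?\<psi> (map_prod \<phi> \<phi> e)) ` parcs G"
      by (simp add: \<phi>(3) image_image)
    also have "\<dots> = (\<lambda>e. e) ` parcs G"
    proof (rule image_cong[OF refl])
      fix e assume "e \<in> parcs G"
      then show "map_prod ?\<psi> ?\<psi> (map_prod \<phi> \<phi> e) = e"
        using inv wellformed' by (cases e) simp
    qed
    finally show ?thesis by simp
  qed
  moreover have "inj_on ?\<psi> (pverts H)" "pverts G = ?\<psi> ` pverts H"
    using \<phi>(1,2) inv by (auto simp: inj_on_the_inv_into image_image)
  ultimately show ?thesis unfolding digraph_iso_pair_iff[OF assms(2)] by blast
qed

lemma digraph_iso_pair_trans:
  fixes G H K :: "nat pair_pre_digraph"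
  assumes "pair_wf_digraph G" "pair_wf_digraph H" "digraph_iso G H" "digraph_iso H K"
  shows "digraph_iso G K"
proof -
  obtain \<phi> where \<phi>: "inj_on \<phi> (pverts G)" "pverts H = \<phi> ` pverts G"
    "parcs H = map_prod \<phi> \<phi> ` parcs G"
    using assms(3) unfolding digraph_iso_pair_iff[OF assms(1)] by blast
  obtain \<psi> where \<psi>: "inj_on \<psi> (pverts H)" "pverts K = \<psi> ` pverts H"
    "parcs K = map_prod \<psi> \<psi> ` parcs H"
    using assms(4) unfolding digraph_iso_pair_iff[OF assms(2)] by blast
  have "inj_on (\<psi> \<circ> \<phi>) (pverts G)"
    using \<phi>(1) \<psi>(1) by (simp add: comp_inj_on \<phi>(2))
  moreover have "parcs K = map_prod (\<psi> \<circ> \<phi>) (\<psi> \<circ> \<phi>) ` parcs G"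
    by (simp add: \<phi>(3) \<psi>(3) image_comp map_prod.comp)
  moreover have "pverts K = (\<psi> \<circ> \<phi>) ` pverts G"
    by (simp add: \<phi>(2) \<psi>(2) image_comp)
  ultimately show ?thesis unfolding digraph_iso_pair_iff[OF assms(1)] by blast
qed


subsection \<open>Unlabelled rooted trees\<close>

text \<open>Edges point towards the root, which is the only vertex without an outgoing edge.\<close>

definition rooted_tree :: "nat pair_pre_digraph \<Rightarrow> bool" where
  "rooted_tree G \<longleftrightarrow> pair_fin_digraph G \<and>
    (\<exists>r \<in> pverts G. out_degree G r = 0 \<and>
      (\<forall>v \<in> pverts G. v \<rightarrow>\<^sup>*\<^bsub>with_proj G\<^esub> r \<and> (v \<noteq> r \<longrightarrow> out_degree G v = 1)))"

definition root_of :: "nat pair_pre_digraph \<Rightarrow> nat" where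
  "root_of G = (THE r. r \<in> pverts G \<and> out_degree G r = 0)"

definition single_vertex :: "nat pair_pre_digraph" where
  "single_vertex = \<lparr>pverts = {0}, parcs = {}\<rparr>"

lemma pair_fin_digraph_single_vertex: "pair_fin_digraph single_vertex"
  by unfold_locales (auto simp: single_vertex_def)

lemma rooted_tree_single_vertex: "rooted_tree single_vertex"
proof -
  interpret pair_fin_digraph single_vertex by (rule pair_fin_digraph_single_vertex)
  have "0 \<rightarrow>\<^sup>*\<^bsub>with_proj single_vertex\<^esub> 0"
    by (rule reachable_refl) (simp add: single_vertex_def)
  moreover have "pverts single_vertex = {0}" "out_degree single_vertex 0 = 0"
    by (simp_all add: single_vertex_def out_degree_def out_arcs_def)
  ultimately show ?thesis
    unfolding rooted_tree_def using pair_fin_digraph_single_vertex by simp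
qed

lemma rooted_tree_imp_wf: "rooted_tree G \<Longrightarrow> pair_wf_digraph G"
  by (simp add: rooted_tree_def pair_fin_digraph_def)

quotient_type rtree = "nat pair_pre_digraph" /
  partial: "\<lambda>G H. rooted_tree G \<and> rooted_tree H \<and> digraph_iso G H"
proof (rule part_equivpI)
  show "\<exists>G. rooted_tree G \<and> rooted_tree G \<and> digraph_iso G G"
    using rooted_tree_single_vertex digraph_iso_pair_refl rooted_tree_imp_wf by blast
  show "symp (\<lambda>G H. rooted_tree G \<and> rooted_tree H \<and> digraph_iso (with_proj G) (with_proj H))"
    using digraph_iso_pair_sym rooted_tree_imp_wf by (blast intro: sympI)
  show "transp (\<lambda>G H. rooted_tree G \<and> rooted_tree H \<and> digraph_iso (with_proj G) (with_proj H))"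
    using digraph_iso_pair_trans rooted_tree_imp_wf by (blast intro: transpI)
qed

lemma rooted_tree_iso:
  fixes G H :: "nat pair_pre_digraph"
  assumes G: "rooted_tree G" and iso: "digraph_iso G H"
  shows "rooted_tree H"
proof -
  interpret G: pair_fin_digraph G using G by (simp add: rooted_tree_def)
  obtain f where f: "pre_digraph.digraph_isomorphism (with_proj G) f"
    and H: "with_proj H = app_iso f (with_proj G)"
    using iso by (auto simp: digraph_iso_def)
  have fin: "fin_digraph (with_proj H)"
    unfolding H by (rule G.fin_digraphI_app_iso[OF f])
  interpret H: fin_digraph "with_proj H" by (rule fin)
  have pf: "pair_fin_digraph H"
    using H.tail_in_verts H.head_in_verts H.finite_verts H.finite_arcs
    by unfold_locales simp_all
  obtain r where r: "r \<in> pverts G" "out_degree G r = 0"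
    "\<And>v. v \<in> pverts G \<Longrightarrow> v \<rightarrow>\<^sup>*\<^bsub>with_proj G\<^esub> r"
    "\<And>v. v \<in> pverts G \<Longrightarrow> v \<noteq> r \<Longrightarrow> out_degree G v = 1"
    using G unfolding rooted_tree_def by blast
  have V: "pverts H = iso_verts f ` pverts G"
    using H by (auto simp: with_proj_def app_iso_def)
  have deg: "out_degree H (iso_verts f v) = out_degree G v" if "v \<in> pverts G" for v
    using G.out_degree_app_iso_eq[OF f, of v] that by (simp add: H)
  have reach: "iso_verts f v \<rightarrow>\<^sup>*\<^bsub>with_proj H\<^esub> iso_verts f r" if "v \<in> pverts G" for v
    unfolding H by (rule G.reachableI_app_iso[OF r(3)[OF that] f])
  show ?thesis
    unfolding rooted_tree_def
  proof (intro conjI bexI[of _ "iso_verts f r"] ballI impI pf)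
    show "iso_verts f r \<in> pverts H" "out_degree H (iso_verts f r) = 0"
      using r(1,2) deg by (simp_all add: V)
    fix w assume "w \<in> pverts H"
    then obtain v where v: "v \<in> pverts G" "w = iso_verts f v" by (auto simp: V)
    show "w \<rightarrow>\<^sup>*\<^bsub>with_proj H\<^esub> iso_verts f r" using reach v by simp
    assume "w \<noteq> iso_verts f r"
    then show "out_degree H w = 1" using r(4) deg v by auto
  qed
qed

lemma rooted_tree_rep: "rooted_tree (rep_rtree \<tau>)"
  and abs_rep_rtree: "abs_rtree (rep_rtree \<tau>) = \<tau>"
  using Quotient_rep_reflp[OF Quotient_rtree, of \<tau>] Quotient_abs_rep[OF Quotient_rtree, of \<tau>]
  by auto

lemma abs_rtree_eqI:
  fixes G H :: "nat pair_pre_digraph"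
  assumes "rooted_tree G" "digraph_iso G H"
  shows "abs_rtree G = abs_rtree H"
  by (rule Quotient_rel_abs[OF Quotient_rtree]) (use assms rooted_tree_iso in auto)

definition bullet :: rtree where
  "bullet = abs_rtree single_vertex"

definition num_vertices :: "rtree \<Rightarrow> nat" where
  "num_vertices \<tau> = card (pverts (rep_rtree \<tau>))"

lemma finite_num_vertices: "finite {\<tau>. num_vertices \<tau> = n}"
proof -
  define S where "S = {G :: nat pair_pre_digraph. pverts G = {..<n} \<and> parcs G \<subseteq> {..<n} \<times> {..<n}}"
  have "S \<subseteq> (\<lambda>E. \<lparr>pverts = {..<n}, parcs = E\<rparr>) ` Pow ({..<n} \<times> {..<n})"
  proof
    fix G assume "G \<in> S"
    then show "G \<in> (\<lambda>E. \<lparr>pverts = {..<n}, parcs = E\<rparr>) ` Pow ({..<n} \<times> {..<n})"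
      by (intro image_eqI[of _ _ "parcs G"]) (auto simp: S_def)
  qed
  then have "finite S" by (rule finite_subset) simp
  moreover have "{\<tau>. num_vertices \<tau> = n} \<subseteq> abs_rtree ` S"
  proof safe
    fix \<tau> assume n: "n = num_vertices \<tau>"
    let ?G = "rep_rtree \<tau>"
    interpret pair_fin_digraph ?G using rooted_tree_rep[of \<tau>] by (simp add: rooted_tree_def)
    obtain \<phi> where "bij_betw \<phi> (pverts ?G) {..<n}"
      using finite_verts ex_bij_betw_finite_nat[of "pverts ?G"]
      by (auto simp: n num_vertices_def atLeast0LessThan)
    then have \<phi>: "inj_on \<phi> (pverts ?G)" "\<phi> ` pverts ?G = {..<n}"
      by (auto simp: bij_betw_def)
    define H where "H = \<lparr>pverts = \<phi> ` pverts ?G, parcs = map_prod \<phi> \<phi> ` parcs ?G\<rparr>"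
    have "digraph_iso ?G H"
      unfolding digraph_iso_pair_iff[OF rooted_tree_imp_wf[OF rooted_tree_rep]]
      using \<phi>(1) by (auto simp: H_def)
    then have "\<tau> = abs_rtree H"
      using abs_rtree_eqI[OF rooted_tree_rep] abs_rep_rtree by metis
    moreover have "H \<in> S"
      using wellformed' \<phi>(2) by (auto simp: S_def H_def)
    ultimately show "\<tau> \<in> abs_rtree ` S" by blast
  qed
  ultimately show ?thesis by (rule finite_subset[OF _ finite_imageI, rotated])
qed

lemma root_of_eqI:
  assumes "rooted_tree G" "r \<in> pverts G" "out_degree G r = 0"
  shows "root_of G = r"
proof -
  have "x = r" if "x \<in> pverts G" "out_degree G x = 0" for x
    using assms that unfolding rooted_tree_def by (metis zero_neq_one)
  then show ?thesis unfolding root_of_def using assms(2,3) by blast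
qed

lemma out_degree_pair: "out_degree (with_proj G) v = card {e \<in> parcs G. fst e = v}"
  by (simp add: out_degree_def out_arcs_def)

definition automorphisms :: "nat pair_pre_digraph \<Rightarrow> (nat \<Rightarrow> nat) set" where
  "automorphisms G = {\<pi>. \<pi> permutes pverts G \<and> map_prod \<pi> \<pi> ` parcs G = parcs G}"

definition symmetry :: "rtree \<Rightarrow> nat" where
  "symmetry \<tau> = card (automorphisms (rep_rtree \<tau>))"


subsection \<open>Directed cycles of unlabelled rooted trees\<close>

definition cycle_of_trees :: "nat pair_pre_digraph \<Rightarrow> bool" where
  "cycle_of_trees G \<longleftrightarrow> pair_fin_digraph G \<and> pverts G \<noteq> {} \<and> connected G \<and>
    (\<forall>v \<in> pverts G. out_degree G v = 1)"

lemma cycle_of_trees_imp_wf: "cycle_of_trees G \<Longrightarrow> pair_wf_digraph G"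
  by (simp add: cycle_of_trees_def pair_fin_digraph_def)

lemma cycle_of_trees_loop: "cycle_of_trees \<lparr>pverts = {0}, parcs = {(0, 0)}\<rparr>"
proof -
  let ?G = "\<lparr>pverts = {0}, parcs = {(0, 0)}\<rparr> :: nat pair_pre_digraph"
  interpret pair_fin_digraph ?G by unfold_locales auto
  have "out_arcs ?G 0 = {(0, 0)}"
    by (auto simp: out_arcs_def)
  moreover have "connected ?G"
    by (auto simp: connected_conv)
  ultimately show ?thesis
    by (auto simp: cycle_of_trees_def out_degree_def pair_fin_digraph_axioms)
qed

quotient_type tree_cycle = "nat pair_pre_digraph" /
  partial: "\<lambda>G H. cycle_of_trees G \<and> cycle_of_trees H \<and> digraph_iso G H"
proof (rule part_equivpI)
  show "\<exists>G. cycle_of_trees G \<and> cycle_of_trees G \<and> digraph_iso G G"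
    using cycle_of_trees_loop digraph_iso_pair_refl cycle_of_trees_imp_wf by blast
  show "symp (\<lambda>G H. cycle_of_trees G \<and> cycle_of_trees H \<and> digraph_iso (with_proj G) (with_proj H))"
    using digraph_iso_pair_sym cycle_of_trees_imp_wf by (blast intro: sympI)
  show "transp (\<lambda>G H. cycle_of_trees G \<and> cycle_of_trees H \<and> digraph_iso (with_proj G) (with_proj H))"
    using digraph_iso_pair_trans cycle_of_trees_imp_wf by (blast intro: transpI)
qed

definition cycle_num_vertices :: "tree_cycle \<Rightarrow> nat" where
  "cycle_num_vertices \<gamma> = card (pverts (rep_tree_cycle \<gamma>))"

definition has_loop :: "tree_cycle \<Rightarrow> bool" where
  "has_loop \<gamma> \<longleftrightarrow> (\<exists>v. (v, v) \<in> parcs (rep_tree_cycle \<gamma>))"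


section \<open>Divergence\<close>

text \<open>
  A formal series of trees (or of cycles of trees) is the function giving its coefficients.
\<close>

type_synonym tree_series = "rtree \<Rightarrow> real"
type_synonym cycle_series = "tree_cycle \<Rightarrow> real"

definition close_at :: "nat pair_pre_digraph \<Rightarrow> nat \<Rightarrow> nat pair_pre_digraph" where
  "close_at G v = \<lparr>pverts = pverts G, parcs = insert (root_of G, v) (parcs G)\<rparr>"

lemma cycle_of_trees_close_at:
  assumes G: "rooted_tree G" and v: "v \<in> pverts G"
  shows "cycle_of_trees (close_at G v)"
proof -
  interpret G: pair_fin_digraph G using G by (simp add: rooted_tree_def)
  obtain r where r: "r \<in> pverts G" "out_degree G r = 0"
    "\<And>v. v \<in> pverts G \<Longrightarrow> v \<rightarrow>\<^sup>*\<^bsub>with_proj G\<^esub> r"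
    "\<And>v. v \<in> pverts G \<Longrightarrow> v \<noteq> r \<Longrightarrow> out_degree G v = 1"
    using G unfolding rooted_tree_def by blast
  have root: "root_of G = r" using G r by (intro root_of_eqI)
  let ?C = "close_at G v"
  have C: "pair_fin_digraph ?C"
    using G.pair_finite_verts G.pair_finite_arcs r(1) v
    by unfold_locales (auto simp: close_at_def root dest: G.wellformed')
  interpret C: pair_fin_digraph ?C by fact
  have no: "{e \<in> parcs G. fst e = r} = {}"
    using r(2) G.pair_finite_arcs by (simp add: out_degree_pair)
  have "out_degree ?C u = 1" if "u \<in> pverts G" for u
  proof (cases "u = r")
    case True
    have "{e \<in> parcs ?C. fst e = r} = {(r, v)}"
      using no by (auto simp: close_at_def root)
    then show ?thesis unfolding out_degree_pair True by simp
  next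
    case False
    then have "{e \<in> parcs ?C. fst e = u} = {e \<in> parcs G. fst e = u}"
      by (auto simp: close_at_def root)
    then show ?thesis using r(4)[OF that False] by (simp add: out_degree_pair)
  qed
  moreover have "connected ?C"
  proof -
    let ?S = "rtrancl_on (pverts G) (symcl (parcs ?C))"
    have sub: "rtrancl_on (pverts G) (parcs G) \<subseteq> ?S"
    proof clarify
      fix x y assume "(x, y) \<in> rtrancl_on (pverts G) (parcs G)"
      then show "(x, y) \<in> ?S"
      proof (induct rule: rtrancl_on_induct)
        case (step u w)
        then show ?case
          by (intro rtrancl_on_into_rtrancl_on[OF step(5)]) (auto simp: symcl_def close_at_def)
      qed auto
    qed
    have "sym ?S"
      by (intro rtrancl_on_sym) (auto simp: symcl_def sym_def)
    have to_r: "(u, r) \<in> ?S" if "u \<in> pverts G" for u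
      using r(3)[OF that] sub by (auto simp: reachable_def)
    then have "(u, w) \<in> ?S" if "u \<in> pverts G" "w \<in> pverts G" for u w
      using that \<open>sym ?S\<close> by (meson rtrancl_on_trans symD)
    then show ?thesis using v by (auto simp: connected_conv close_at_def)
  qed
  ultimately show ?thesis using C v by (auto simp: cycle_of_trees_def close_at_def)
qed

text \<open>The divergence of a single tree: the coefficient of \<open>\<gamma>\<close> counts the vertices \<open>v\<close>
  for which the arrow from the root to \<open>v\<close> produces \<open>\<gamma>\<close>.\<close>

definition tree_divergence :: "rtree \<Rightarrow> cycle_series" where
  "tree_divergence \<tau> \<gamma> =
    real (card {v \<in> pverts (rep_rtree \<tau>). abs_tree_cycle (close_at (rep_rtree \<tau>) v) = \<gamma>})"

text \<open>Closing preserves the number of vertices, so the linear extension to series is, in each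
  coefficient, a sum over the finitely many trees (\<open>finite_num_vertices\<close>) of one size.\<close>

definition divergence :: "tree_series \<Rightarrow> cycle_series" where
  "divergence p \<gamma> = (\<Sum>\<tau> | num_vertices \<tau> = cycle_num_vertices \<gamma>. p \<tau> * tree_divergence \<tau> \<gamma>)"

text \<open>The quotient by the span of the cycles of length one, i.e. of those having a loop,
  is realised by putting their coefficients to zero.\<close>

definition reduced_divergence :: "tree_series \<Rightarrow> cycle_series" where
  "reduced_divergence p \<gamma> = (if has_loop \<gamma> then 0 else divergence p \<gamma>)"

definition volume_preserving :: "tree_series \<Rightarrow> bool" where
  "volume_preserving p \<longleftrightarrow> reduced_divergence p = (\<lambda>_. 0)"


section \<open>B-series methods and backward error analysis\<close>

text \<open>
  Elementary differentials are identified with trees; thus \<open>f\<close> itself is the tree \<open>bullet\<close>.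
\<close>

definition f_series :: tree_series where
  "f_series \<tau> = (if \<tau> = bullet then 1 else 0)"

text \<open>The increment \<open>y\<^sub>n\<^sub>+\<^sub>1 - y\<^sub>n\<close> of the method with coefficients \<open>a\<close>.\<close>

definition bseries_increment :: "real \<Rightarrow> (rtree \<Rightarrow> real) \<Rightarrow> tree_series" where
  "bseries_increment h a \<tau> = h ^ num_vertices \<tau> / real (symmetry \<tau>) * a \<tau>"

definition modified_field :: "real \<Rightarrow> (rtree \<Rightarrow> real) \<Rightarrow> tree_series" where
  "modified_field h b \<tau> = h ^ (num_vertices \<tau> - 1) / real (symmetry \<tau>) * b \<tau>"

text \<open>
  The derivative of \<open>F(\<tau>)(f)\<close> in direction \<open>F(\<rho>)(f)\<close> is, by the product rule, the sum over all
  vertices \<open>v\<close> of \<open>\<tau>\<close> of the elementary differential of the tree in which \<open>\<rho>\<close> is attached to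
  \<open>\<tau>\<close> by an edge from the root of \<open>\<rho>\<close> to \<open>v\<close>. In \<open>graft_at\<close> the vertices of \<open>\<rho>\<close> are made odd
  and those of \<open>\<tau>\<close> even, which makes them disjoint.
\<close>

definition graft_at :: "nat pair_pre_digraph \<Rightarrow> nat pair_pre_digraph \<Rightarrow> nat \<Rightarrow> nat pair_pre_digraph" where
  "graft_at R T v =
    (let ev = (\<lambda>n. 2 * n); od = (\<lambda>n. 2 * n + 1) in
     \<lparr>pverts = od ` pverts R \<union> ev ` pverts T,
      parcs = insert (od (root_of R), ev v) (map_prod od od ` parcs R \<union> map_prod ev ev ` parcs T)\<rparr>)"

lemma rooted_tree_graft_at:
  assumes R: "rooted_tree R" and T: "rooted_tree T" and v: "v \<in> pverts T"
  shows "rooted_tree (graft_at R T v)"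
proof -
  interpret R: pair_fin_digraph R using R by (simp add: rooted_tree_def)
  interpret T: pair_fin_digraph T using T by (simp add: rooted_tree_def)
  obtain r where r: "r \<in> pverts R" "out_degree R r = 0"
    "\<And>v. v \<in> pverts R \<Longrightarrow> v \<rightarrow>\<^sup>*\<^bsub>with_proj R\<^esub> r"
    "\<And>v. v \<in> pverts R \<Longrightarrow> v \<noteq> r \<Longrightarrow> out_degree R v = 1"
    using R unfolding rooted_tree_def by blast
  obtain t where t: "t \<in> pverts T" "out_degree T t = 0"
    "\<And>v. v \<in> pverts T \<Longrightarrow> v \<rightarrow>\<^sup>*\<^bsub>with_proj T\<^esub> t"
    "\<And>v. v \<in> pverts T \<Longrightarrow> v \<noteq> t \<Longrightarrow> out_degree T v = 1"
    using T unfolding rooted_tree_def by blast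
  have root: "root_of R = r" using R r by (intro root_of_eqI)
  let ?ev = "\<lambda>n::nat. 2 * n" let ?od = "\<lambda>n::nat. 2 * n + 1"
  let ?G = "graft_at R T v"
  have VG: "pverts ?G = ?od ` pverts R \<union> ?ev ` pverts T"
    and EG: "parcs ?G = insert (?od r, ?ev v) (map_prod ?od ?od ` parcs R \<union> map_prod ?ev ?ev ` parcs T)"
    by (simp_all add: graft_at_def Let_def root)
  have G: "pair_fin_digraph ?G"
    using R.pair_finite_verts R.pair_finite_arcs T.pair_finite_verts T.pair_finite_arcs r(1) v
    by unfold_locales (auto simp: VG EG dest: R.wellformed' T.wellformed')
  interpret G: pair_fin_digraph ?G by fact
  have par: "2 * x \<noteq> Suc (2 * y)" "Suc (2 * y) \<noteq> 2 * x" for x y :: nat by presburger+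
  have noR: "{e \<in> parcs R. fst e = r} = {}"
    using r(2) R.pair_finite_arcs by (simp add: out_degree_pair)
  have degT: "out_degree ?G (?ev u) = out_degree T u" for u
  proof -
    have "{e \<in> parcs ?G. fst e = ?ev u} = map_prod ?ev ?ev ` {e \<in> parcs T. fst e = u}"
      by (auto simp: EG par)
    then show ?thesis unfolding out_degree_pair by (simp add: card_image inj_on_def)
  qed
  have degR: "out_degree ?G (?od u) = out_degree R u" if "u \<noteq> r" for u
  proof -
    have "{e \<in> parcs ?G. fst e = ?od u} = map_prod ?od ?od ` {e \<in> parcs R. fst e = u}"
      using that by (auto simp: EG par)
    then show ?thesis unfolding out_degree_pair by (simp add: card_image inj_on_def)
  qed
  have "{e \<in> parcs ?G. fst e = ?od r} = {(?od r, ?ev v)}"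
    using noR by (auto simp: EG par)
  then have degr: "out_degree ?G (?od r) = 1" unfolding out_degree_pair by simp
  have reachT: "?ev u \<rightarrow>\<^sup>*\<^bsub>with_proj ?G\<^esub> ?ev w" if "u \<rightarrow>\<^sup>*\<^bsub>with_proj T\<^esub> w" for u w
    using that unfolding reachable_def
  proof (induct rule: rtrancl_on_induct)
    case base then show ?case by (auto simp: VG)
  next
    case (step x y) 
    then show ?case by (intro rtrancl_on_into_rtrancl_on[OF step(5)]) (auto simp: VG EG intro: rev_image_eqI)
  qed
  have reachR: "?od u \<rightarrow>\<^sup>*\<^bsub>with_proj ?G\<^esub> ?od w" if "u \<rightarrow>\<^sup>*\<^bsub>with_proj R\<^esub> w" for u w
    using that unfolding reachable_def
  proof (induct rule: rtrancl_on_induct)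
    case base then show ?case by (auto simp: VG)
  next
    case (step x y) 
    then show ?case by (intro rtrancl_on_into_rtrancl_on[OF step(5)]) (auto simp: VG EG intro: rev_image_eqI)
  qed
  have "?od r \<rightarrow>\<^sup>*\<^bsub>with_proj ?G\<^esub> ?ev v"
    by (rule G.reachable_adjI) (auto simp: EG)
  then have rt: "?od u \<rightarrow>\<^sup>*\<^bsub>with_proj ?G\<^esub> ?ev t" if "u \<in> pverts R" for u
    using reachR[OF r(3)[OF that]] reachT[OF t(3)[OF v]] by (meson G.reachable_trans)
  show ?thesis
    unfolding rooted_tree_def
  proof (intro conjI bexI[of _ "?ev t"] ballI impI G)
    show "?ev t \<in> pverts ?G" "out_degree ?G (?ev t) = 0"
      using t(1,2) degT by (simp_all add: VG)
    fix w assume "w \<in> pverts ?G"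
    then consider (R) u where "u \<in> pverts R" "w = ?od u" | (T) u where "u \<in> pverts T" "w = ?ev u"
      by (auto simp: VG)
    then have "w \<rightarrow>\<^sup>*\<^bsub>with_proj ?G\<^esub> ?ev t \<and> (w \<noteq> ?ev t \<longrightarrow> out_degree ?G w = 1)"
    proof cases
      case R
      then show ?thesis using rt degr degR r(4) by (cases "u = r") simp_all
    next
      case T
      then show ?thesis using reachT[OF t(3)] degT t(4) by simp
    qed
    then show "w \<rightarrow>\<^sup>*\<^bsub>with_proj ?G\<^esub> ?ev t" "w \<noteq> ?ev t \<Longrightarrow> out_degree ?G w = 1"
      by blast+
  qed
qed
definition graft_coeff :: "rtree \<Rightarrow> rtree \<Rightarrow> tree_series" where
  "graft_coeff \<rho> \<tau> \<theta> =
    real (card {v \<in> pverts (rep_rtree \<tau>). abs_rtree (graft_at (rep_rtree \<rho>) (rep_rtree \<tau>) v) = \<theta>})"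

text \<open>The series of the derivative of \<open>q\<close> along the vector field \<open>p\<close>, that is \<open>q'(p)\<close>.\<close>

definition derivative_along :: "tree_series \<Rightarrow> tree_series \<Rightarrow> tree_series" where
  "derivative_along p q \<theta> =
    (\<Sum>(\<rho>, \<tau>) | num_vertices \<rho> + num_vertices \<tau> = num_vertices \<theta>. p \<rho> * q \<tau> * graft_coeff \<rho> \<tau> \<theta>)"

text \<open>
  The increment \<open>y(t) - y(0)\<close> of the solution of \<open>y' = p(y)\<close> by its Taylor series in \<open>t\<close>: the
  \<open>k\<close>-th derivative of \<open>y\<close> is \<open>g\<^sub>k(y)\<close> with \<open>g\<^sub>1 = p\<close> and \<open>g\<^sub>k\<^sub>+\<^sub>1 = g\<^sub>k'(p)\<close>.
  Since \<open>g\<^sub>k\<close> has only trees with at least \<open>k\<close> vertices, the terms with \<open>k > num_vertices \<theta>\<close> vanish.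
\<close>

definition exact_increment :: "real \<Rightarrow> tree_series \<Rightarrow> tree_series" where
  "exact_increment t p \<theta> =
    (\<Sum>k = 1..num_vertices \<theta>. t ^ k / fact k * (derivative_along p ^^ (k - 1)) p \<theta>)"

text \<open>\<open>b\<close> are the coefficients of the modified equation of the method with coefficients \<open>a\<close>.\<close>

definition modified_coeffs :: "real \<Rightarrow> (rtree \<Rightarrow> real) \<Rightarrow> (rtree \<Rightarrow> real) \<Rightarrow> bool" where
  "modified_coeffs h a b \<longleftrightarrow> bseries_increment h a = exact_increment h (modified_field h b)"

text \<open>A method is consistent if its increment starts with \<open>h f\<close>.\<close>

definition consistent :: "(rtree \<Rightarrow> real) \<Rightarrow> bool" where
  "consistent a \<longleftrightarrow> a bullet = 1"

end

theory Submission
  imports Defs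
begin

text \<open>
  Multiply the coefficient of each tree by its symmetry. In terms of these values, volume
  preservation says that for every directed cycle of trees without loop the values of the trees
  obtained by removing one arc of the cycle add up to zero. Cycles of length two show that moving
  the root to an adjacent vertex changes the sign; cycles of length three then yield, for any set
  of at least two trees, that the trees obtained by attaching the roots of all of them to the root
  of one of them have values adding up to zero.

  Let \<open>T\<close> be a tree with one vertex more whose root has at least two children. These relations
  say that the values of the contractions of the edges of \<open>T\<close> form a flow from the leaves to the
  root that is conserved at every inner vertex and vanishes at the root. Hence the contractions of
  the edges at the leaves add up to zero. If \<open>T\<close> arises from a tree by adding a leaf at the root,
  these contractions are copies of that tree and trees with more children at the root, so all
  values vanish by downward induction on the number of children of the root.
\<close>

section \<open>Rooted forests\<close>

text \<open>\<open>F\<close> sends every vertex to its parent and \<open>U\<close> is the set of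
  roots. No reachability of a root is demanded, since finiteness and acyclicity already give it. The
  forests with a single root are the rooted trees, and cutting arcs or deleting vertices stays
  within the notion.\<close>

definition rooted_forest :: "'a set \<Rightarrow> 'a set \<Rightarrow> 'a rel \<Rightarrow> bool" where
  "rooted_forest V U F \<longleftrightarrow>
    finite V \<and> F \<subseteq> V \<times> V \<and> single_valued F \<and> acyclic F \<and> V - Domain F = U"

lemma rooted_forestD:
  assumes "rooted_forest V U F"
  shows "finite V" "F \<subseteq> V \<times> V" "single_valued F" "acyclic F" "V - Domain F = U"
    "U \<subseteq> V" "finite U" "finite F"
proof -
  show fin: "finite V" and sub: "F \<subseteq> V \<times> V"
    and "single_valued F" "acyclic F" "V - Domain F = U" "U \<subseteq> V" "finite U"
    using assms by (auto simp: rooted_forest_def)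
  show "finite F"
    using finite_subset[OF sub] fin by simp
qed

lemma rooted_forest_not_loop: "rooted_forest V U F \<Longrightarrow> (x, x) \<notin> F"
  by (auto simp: rooted_forest_def acyclic_def)

lemma rooted_forest_root_noarc: "rooted_forest V U F \<Longrightarrow> u \<in> U \<Longrightarrow> (u, x) \<notin> F"
  by (auto simp: rooted_forest_def)

lemma rooted_forest_rtrancl_from_root:
  assumes "rooted_forest V U F" "u \<in> U" "(u, x) \<in> F\<^sup>*"
  shows "x = u"
  using assms(3) rooted_forest_root_noarc[OF assms(1,2)] by (metis converse_rtranclE)

lemma rooted_forest_rtrancl_root_unique:
  assumes F: "rooted_forest V U F" and "r \<in> U" "s \<in> U" "(c, r) \<in> F\<^sup>*" "(c, s) \<in> F\<^sup>*"
  shows "r = s"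
  using single_valued_confluent[OF rooted_forestD(3)[OF F] assms(4,5)]
    rooted_forest_rtrancl_from_root[OF F] assms(2,3) by blast

lemma rooted_forest_rtrancl_root_in_verts:
  assumes F: "rooted_forest V U F" and "r \<in> U" "(c, r) \<in> F\<^sup>*"
  shows "c \<in> V"
  using assms(3)
proof (cases rule: converse_rtranclE)
  case base
  then show ?thesis using rooted_forestD(6)[OF F] assms(2) by blast
next
  case (step y)
  then show ?thesis using rooted_forestD(2)[OF F] by blast
qed

text \<open>The converse of a finite acyclic relation is well-founded, so following the arcs comes
  to an end, and only a root can be the end.\<close>

lemma rooted_forest_ex_root:
  assumes F: "rooted_forest V U F" and x: "x \<in> V"
  shows "\<exists>u\<in>U. (x, u) \<in> F\<^sup>*"
proof -
  have "wf (F\<inverse>)"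
    using rooted_forestD[OF F] by (simp add: finite_acyclic_wf_converse)
  then show ?thesis using x
  proof (induction x rule: wf_induct_rule)
    case (less x)
    show ?case
    proof (cases "x \<in> Domain F")
      case True
      then obtain y where y: "(x, y) \<in> F" by blast
      then have "y \<in> V" using rooted_forestD(2)[OF F] by blast
      then show ?thesis using less.IH[of y] y by (meson converseI converse_rtrancl_into_rtrancl)
    next
      case False
      then show ?thesis using rooted_forestD(5)[OF F] less.prems by blast
    qed
  qed
qed

lemma rooted_forest_insert:
  assumes F: "rooted_forest V U F" and u: "u \<in> U" and c: "c \<in> V" and n: "(c, u) \<notin> F\<^sup>*"
  shows "rooted_forest V (U - {u}) (insert (u, c) F)"
proof -
  have "single_valued (insert (u, c) F)"
    using rooted_forestD(3)[OF F] rooted_forest_root_noarc[OF F u]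
    by (auto simp: single_valued_def)
  then show ?thesis
    using rooted_forestD[OF F] u c n by (auto simp: rooted_forest_def acyclic_insert)
qed

text \<open>The vertex \<open>c\<close> lies in the tree of \<open>r\<close>, and this persists
  while the roots in \<open>S\<close> are hung on \<open>c\<close> one by one. Since a vertex lies
  below only one root, none of these steps closes a cycle.\<close>

lemma rooted_forest_join:
  assumes F: "rooted_forest V U F" and S: "S \<subseteq> U" and c: "(c, r) \<in> F\<^sup>*" and r: "r \<in> U - S"
  shows "rooted_forest V (U - S) (F \<union> S \<times> {c})"
proof -
  have "finite S" using S rooted_forestD(7)[OF F] finite_subset by blast
  then show ?thesis using S r
  proof (induction S rule: finite_induct)
    case empty
    then show ?case using F by simp
  next
    case (insert s S)
    let ?F = "F \<union> S \<times> {c}"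
    have IH: "rooted_forest V (U - S) ?F" using insert by auto
    have cr: "(c, r) \<in> ?F\<^sup>*" using c by (meson rtrancl_mono subsetD Un_upper1)
    have s: "s \<in> U - S" "r \<in> U - S" "r \<noteq> s" using insert by auto
    then have "(c, s) \<notin> ?F\<^sup>*" using rooted_forest_rtrancl_root_unique[OF IH] cr by metis
    moreover have "c \<in> V" using rooted_forest_rtrancl_root_in_verts[OF F _ c] r by blast
    ultimately have "rooted_forest V (U - S - {s}) (insert (s, c) ?F)"
      using rooted_forest_insert[OF IH s(1)] by blast
    moreover have "insert (s, c) ?F = F \<union> insert s S \<times> {c}" by auto
    moreover have "U - S - {s} = U - insert s S" by auto
    ultimately show ?case by (simp only:)
  qed
qed

lemma rooted_forest_join_root:
  assumes "rooted_forest V U F" "S \<subseteq> U" "r \<in> U - S"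
  shows "rooted_forest V (U - S) (F \<union> S \<times> {r})"
  using rooted_forest_join[OF assms(1,2) _ assms(3)] by blast

lemma rooted_forest_insert_root:
  assumes "rooted_forest V U F" "u \<in> U" "c \<in> U" "u \<noteq> c"
  shows "rooted_forest V (U - {u}) (insert (u, c) F)"
  using rooted_forest_join_root[OF assms(1), of "{u}" c] assms(2-4) by simp

lemma rooted_forest_subset:
  assumes "rooted_forest V U F" "F' \<subseteq> F"
  shows "rooted_forest V (V - Domain F') F'"
proof -
  have "acyclic F'" using rooted_forestD(4)[OF assms(1)] assms(2) acyclic_subset by blast
  moreover have "single_valued F'"
    using rooted_forestD(3)[OF assms(1)] assms(2) single_valued_subset by blast
  ultimately show ?thesis
    using rooted_forestD[OF assms(1)] assms(2) by (auto simp: rooted_forest_def)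
qed

lemma rooted_forest_remove_arc:
  assumes F: "rooted_forest V U F" and e: "(u, c) \<in> F"
  shows "rooted_forest V (insert u U) (F - {(u, c)})"
proof -
  have "V - Domain (F - {(u, c)}) = insert u (V - Domain F)"
    using e rooted_forestD(2,3)[OF F] by (auto simp: single_valued_def)
  then show ?thesis
    using rooted_forest_subset[OF F, of "F - {(u, c)}"] rooted_forestD(5)[OF F] by auto
qed

section \<open>Paths of a given length\<close>

lemma relpow_subset_mono:
  fixes R S :: "'a rel"
  shows "R \<subseteq> S \<Longrightarrow> R ^^ n \<subseteq> S ^^ n"
  by (induction n) (simp_all add: relcomp_mono)

text \<open>A path to \<open>y\<close> through the arc \<open>(y, z)\<close> would lead from
  \<open>z\<close> back to \<open>y\<close>. The length is recorded because
  \<open>star_sum_below\<close> is an induction on it.\<close>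

lemma relpow_avoid_arc:
  assumes "acyclic F" "(y, z) \<in> F" "(p, y) \<in> F ^^ n"
  shows "(p, y) \<in> (F - {(y, z)}) ^^ n"
  using assms(3)
proof (induction n arbitrary: p)
  case 0
  then show ?case by simp
next
  case (Suc n)
  obtain q where q: "(p, q) \<in> F" "(q, y) \<in> F ^^ n"
    using relpow_Suc_D2[OF Suc.prems] by blast
  have "(p, q) \<noteq> (y, z)"
  proof
    assume "(p, q) = (y, z)"
    then have "(z, y) \<in> F\<^sup>*" using q(2) by (auto intro: relpow_imp_rtrancl)
    then show False using assms(1,2) by (meson acyclic_def rtrancl_into_trancl2)
  qed
  then show ?case using q(1) Suc.IH[OF q(2)] by (intro relpow_Suc_I2) auto
qed


section \<open>Functions on rooted trees whose sums over cycles vanish\<close>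

text \<open>\<open>\<beta>\<close> stands for the coefficient of a tree times the order of its
  symmetry group. The arc \<open>(r, v)\<close> closes the tree to a cycle of length at least two,
  and the sum runs over all ways of cutting the result back to a tree. The type of the vertices is
  kept arbitrary, so that only the combinatorics of arcs matters here.\<close>

locale cycle_sum_zero =
  fixes \<beta> :: "'a set \<Rightarrow> 'a rel \<Rightarrow> real"
  assumes relabel: "\<And>V r F \<phi>. rooted_forest V {r} F \<Longrightarrow> inj_on \<phi> V \<Longrightarrow>
      \<beta> (\<phi> ` V) (map_prod \<phi> \<phi> ` F) = \<beta> V F"
    and cycle_sum: "\<And>V r F v. rooted_forest V {r} F \<Longrightarrow> v \<in> V \<Longrightarrow> v \<noteq> r \<Longrightarrow>
      (\<Sum>e | e \<in> insert (r, v) F \<and> (\<exists>s. rooted_forest V {s} (insert (r, v) F - {e})).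
        \<beta> V (insert (r, v) F - {e})) = 0"
begin

text \<open>Cutting an arc outside \<open>Z\<close> would leave the cycle contained in
  \<open>Z\<close> intact, so the arcs of \<open>Z\<close> are exactly those that contribute to
  \<open>cycle_sum\<close>. This allows the arcs of short cycles to be listed explicitly.\<close>

lemma cycle_arcs_sum:
  assumes F: "rooted_forest V {r} F" "v \<in> V" "v \<noteq> r"
    and Z: "Z \<subseteq> insert (r, v) F" "\<not> acyclic Z"
    and trees: "\<And>e. e \<in> Z \<Longrightarrow> \<exists>s. rooted_forest V {s} (insert (r, v) F - {e})"
  shows "(\<Sum>e\<in>Z. \<beta> V (insert (r, v) F - {e})) = 0"
proof -
  have "e \<in> Z" if "rooted_forest V {s} (insert (r, v) F - {e})" for e s
  proof (rule ccontr)
    assume "e \<notin> Z"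
    then have "Z \<subseteq> insert (r, v) F - {e}" using Z(1) by blast
    then show False using Z(2) rooted_forestD(4)[OF that] acyclic_subset by blast
  qed
  then have "{e. e \<in> insert (r, v) F \<and> (\<exists>s. rooted_forest V {s} (insert (r, v) F - {e}))} = Z"
    using trees Z(1) by blast
  then show ?thesis using cycle_sum[OF F] by simp
qed

text \<open>This is the cycle of length two through \<open>u\<close> and \<open>c\<close>: the two
  summands are the same tree with its root at either end of one edge.\<close>

lemma flip:
  assumes F: "rooted_forest V {u, c} F" and ne: "u \<noteq> c"
  shows "\<beta> V (insert (u, c) F) = - \<beta> V (insert (c, u) F)"
proof -
  let ?C = "insert (c, u) (insert (u, c) F)"
  have uc: "rooted_forest V {c} (insert (u, c) F)"
    using rooted_forest_insert_root[OF F, of u c] ne by (auto simp: insert_Diff_if)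
  have cu: "rooted_forest V {u} (insert (c, u) F)"
    using rooted_forest_insert_root[OF F, of c u] ne by (auto simp: insert_Diff_if)
  have nF: "(u, c) \<notin> F" "(c, u) \<notin> F"
    using rooted_forest_root_noarc[OF F] by auto
  have e: "?C - {(c, u)} = insert (u, c) F" "?C - {(u, c)} = insert (c, u) F"
    using nF ne by auto
  have "(\<Sum>e\<in>{(u, c), (c, u)}. \<beta> V (?C - {e})) = 0"
  proof (rule cycle_arcs_sum[OF uc])
    show "u \<in> V" using rooted_forestD(6)[OF F] by simp
    have "(u, u) \<in> {(u, c), (c, u)}\<^sup>+" by (rule trancl_into_trancl[of _ c]) auto
    then show "\<not> acyclic {(u, c), (c, u)}" by (auto simp: acyclic_def)
    show "\<exists>s. rooted_forest V {s} (?C - {e})" if "e \<in> {(u, c), (c, u)}" for e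
      using that uc cu e by (elim insertE) auto
  qed (use ne in auto)
  then show ?thesis using ne e by simp
qed

text \<open>The three summands are the paths that remain when one arc of the cycle from
  \<open>x\<close> over \<open>y\<close> and \<open>z\<close> back to \<open>x\<close> is
  cut.\<close>

lemma triangle:
  assumes F: "rooted_forest V {x, y, z} F" and ne: "x \<noteq> y" "y \<noteq> z" "x \<noteq> z"
  shows "\<beta> V (insert (z, x) (insert (y, z) F)) + \<beta> V (insert (x, y) (insert (z, x) F))
    + \<beta> V (insert (y, z) (insert (x, y) F)) = 0"
proof -
  let ?Z = "{(x, y), (y, z), (z, x)}"
  let ?C = "insert (z, x) (insert (y, z) (insert (x, y) F))"
  have path: "rooted_forest V {c} (insert (b, c) (insert (a, b) F))"
    if "{a, b, c} = {x, y, z}" "a \<noteq> b" "b \<noteq> c" "a \<noteq> c" for a b c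
  proof -
    have "rooted_forest V ({a, b, c} - {a}) (insert (a, b) F)"
      using rooted_forest_insert_root[OF F, of a b] that by (metis insertI1 insertI2)
    moreover have "{a, b, c} - {a} = {b, c}" using that by auto
    ultimately have "rooted_forest V ({b, c} - {b}) (insert (b, c) (insert (a, b) F))"
      using rooted_forest_insert_root[of V "{b, c}" _ b c] that by auto
    moreover have "{b, c} - {b} = {c}" using that by auto
    ultimately show ?thesis by simp
  qed
  have nF: "(a, b) \<notin> F" if "a \<in> {x, y, z}" for a b
    using rooted_forest_root_noarc[OF F that] .
  have e: "?C - {(x, y)} = insert (z, x) (insert (y, z) F)"
    "?C - {(y, z)} = insert (x, y) (insert (z, x) F)"
    "?C - {(z, x)} = insert (y, z) (insert (x, y) F)"
    using nF ne by auto
  have p: "rooted_forest V {z} (insert (y, z) (insert (x, y) F))"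
    "rooted_forest V {x} (insert (z, x) (insert (y, z) F))"
    "rooted_forest V {y} (insert (x, y) (insert (z, x) F))"
    using ne by (auto intro!: path)
  have "(\<Sum>e\<in>?Z. \<beta> V (?C - {e})) = 0"
  proof (rule cycle_arcs_sum[OF p(1)])
    show "x \<in> V" using rooted_forestD(6)[OF F] by simp
    have "(x, z) \<in> ?Z\<^sup>+" by (rule trancl_into_trancl[of _ y]) auto
    then have "(x, x) \<in> ?Z\<^sup>+" by (rule trancl_into_trancl) auto
    then show "\<not> acyclic ?Z" by (auto simp: acyclic_def)
    show "\<exists>s. rooted_forest V {s} (?C - {e})" if "e \<in> ?Z" for e
      using that p e by (elim insertE) auto
  qed (use ne in auto)
  then show ?thesis using ne e by simp
qed

text \<open>Reversing the last arc of each path in \<open>triangle\<close> turns it into a star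
  around its middle vertex. All three signs change, so the sum remains zero.\<close>

lemma star_sum_3:
  assumes F: "rooted_forest V {x, y, z} F" and ne: "x \<noteq> y" "y \<noteq> z" "x \<noteq> z"
  shows "(\<Sum>c\<in>{x, y, z}. \<beta> V (F \<union> ({x, y, z} - {c}) \<times> {c})) = 0"
proof -
  have fl: "\<beta> V (insert (b, c) (insert (a, b) F)) = - \<beta> V (F \<union> ({x, y, z} - {b}) \<times> {b})"
    if abc: "{a, b, c} = {x, y, z}" "a \<noteq> b" "b \<noteq> c" "a \<noteq> c" for a b c
  proof -
    have "rooted_forest V ({a, b, c} - {a}) (insert (a, b) F)"
      using rooted_forest_insert_root[OF F, of a b] that by (metis insertI1 insertI2)
    moreover have "{a, b, c} - {a} = {b, c}" using that by auto
    ultimately have "\<beta> V (insert (b, c) (insert (a, b) F)) = - \<beta> V (insert (c, b) (insert (a, b) F))"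
      using flip abc(3) by simp
    moreover have "insert (c, b) (insert (a, b) F) = F \<union> ({a, b, c} - {b}) \<times> {b}"
      using abc(2-) by auto
    ultimately show ?thesis using abc(1) by simp
  qed
  show ?thesis
    using triangle[OF assms] fl[of y z x] fl[of z x y] fl[of x y z] ne
    by (simp add: insert_commute)
qed

text \<open>
  Merging the branches in \<open>S\<close> with the branch \<open>i\<close> expresses the summand of \<open>i\<close> by trees with two
  adjacent centres. Summed over all \<open>i\<close> and all \<open>S\<close> of size \<open>s\<close>, exchanging the centres changes
  the sign and replaces \<open>s\<close> by \<open>card U - 2 - s\<close>, so the cases \<open>s = 1\<close> and \<open>s = card U - 3\<close> cancel.
\<close>

lemma star_sum:
  assumes "rooted_forest V U F" "2 \<le> card U"
  shows "(\<Sum>c\<in>U. \<beta> V (F \<union> (U - {c}) \<times> {c})) = 0"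
  using assms
proof (induction "card U" arbitrary: U F rule: less_induct)
  case less
  note F = less.prems(1)
  have fin: "finite U" by (rule rooted_forestD(7)[OF F])
  define m where "m = card U"
  consider "m = 2" | "m = 3" | "4 \<le> m" using less.prems(2) m_def by linarith
  then show ?case
  proof cases
    case 1
    then obtain u c where U: "U = {u, c}" "u \<noteq> c" unfolding m_def card_2_iff by blast
    then have "U - {u} = {c}" "U - {c} = {u}" by auto
    then show ?thesis using flip[of V u c F] F U by simp
  next
    case 2
    then obtain x y z where U: "U = {x, y, z}" "x \<noteq> y" "y \<noteq> z" "x \<noteq> z"
      unfolding m_def card_3_iff by blast
    show ?thesis using star_sum_3[of V x y z F] F U by blast
  next
    case 3
    define A where "A i = \<beta> V (F \<union> (U - {i}) \<times> {i})" for i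
    \<comment> \<open>The branches in \<open>S\<close> hang on \<open>i\<close>, and all other
      roots, \<open>i\<close> among them, hang on \<open>j\<close>.\<close>
    define D where "D i j S = \<beta> V (F \<union> S \<times> {i} \<union> (U - S - {j}) \<times> {j})" for i j S
    define X where "X s = (\<Sum>i\<in>U. \<Sum>j\<in>U - {i}. \<Sum>S | S \<subseteq> U - {i, j} \<and> card S = s. D i j S)" for s
    \<comment> \<open>Once \<open>S\<close> hangs on \<open>i\<close>, the roots
      \<open>U - S\<close> are fewer but still at least two, so the induction hypothesis applies.
      Its summand with centre \<open>i\<close> is the full star \<open>A i\<close>.\<close>
    have merge: "A i + (\<Sum>j\<in>U - S - {i}. D i j S) = 0"
      if i: "i \<in> U" and S: "S \<subseteq> U - {i}" and s: "1 \<le> card S" "card S \<le> m - 2" for i S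
    proof -
      let ?F = "F \<union> S \<times> {i}"
      have "rooted_forest V (U - S) ?F"
        by (rule rooted_forest_join_root[OF F]) (use i S in auto)
      moreover have "finite S" using S fin finite_subset by blast
      then have "card (U - S) = m - card S" using S m_def by (auto intro: card_Diff_subset)
      then have "card (U - S) < card U" "2 \<le> card (U - S)" using s 3 m_def by auto
      ultimately have "(\<Sum>j\<in>U - S. \<beta> V (?F \<union> (U - S - {j}) \<times> {j})) = 0"
        using less.hyps by blast
      moreover have "F \<union> S \<times> {i} \<union> (U - S - {i}) \<times> {i} = F \<union> (U - {i}) \<times> {i}"
        using S by auto
      moreover have "i \<in> U - S" using i S by auto
      ultimately show ?thesis
        using fin by (simp add: A_def D_def sum.remove[of "U - S" i])
    qed
    have D_flip: "D i j S = - D j i (U - {i, j} - S)"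
      if ij: "i \<in> U" "j \<in> U" "i \<noteq> j" and S: "S \<subseteq> U - {i, j}" for i j S
    proof -
      let ?R = "U - {i, j} - S"
      let ?F = "F \<union> S \<times> {i} \<union> ?R \<times> {j}"
      have "rooted_forest V (U - S) (F \<union> S \<times> {i})"
        by (rule rooted_forest_join_root[OF F]) (use ij S in auto)
      then have "rooted_forest V (U - S - ?R) ?F"
        by (rule rooted_forest_join_root) (use ij S in auto)
      moreover have "U - S - ?R = {i, j}" using ij S by auto
      ultimately have "\<beta> V (insert (i, j) ?F) = - \<beta> V (insert (j, i) ?F)"
        using flip ij(3) by simp
      moreover have "insert (i, j) ?F = F \<union> S \<times> {i} \<union> (U - S - {j}) \<times> {j}"
        using ij S by auto
      moreover have "insert (j, i) ?F = F \<union> ?R \<times> {j} \<union> (U - ?R - {i}) \<times> {i}"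
        using ij S by auto
      ultimately show ?thesis by (simp add: D_def)
    qed
    \<comment> \<open>Here \<open>merge\<close> is summed over all \<open>S\<close> of size
      \<open>s\<close> that avoid \<open>i\<close>. Each \<open>A i\<close> then occurs once for
      every such \<open>S\<close>, which gives the binomial coefficient.\<close>
    have rel: "real ((m - 1) choose s) * (\<Sum>i\<in>U. A i) + X s = 0"
      if s: "1 \<le> s" "s \<le> m - 2" for s
    proof -
      have "real ((m - 1) choose s) * A i
        + (\<Sum>j\<in>U - {i}. \<Sum>S | S \<subseteq> U - {i, j} \<and> card S = s. D i j S) = 0" if i: "i \<in> U" for i
      proof -
        let ?\<S> = "{S. S \<subseteq> U - {i} \<and> card S = s}"
        have c: "card ?\<S> = (m - 1) choose s"
          using fin i by (simp add: n_subsets m_def)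
        have "finite ?\<S>" by (rule finite_subset[of _ "Pow (U - {i})"]) (use fin in auto)
        then have sw: "(\<Sum>S\<in>?\<S>. \<Sum>j | j \<in> U - {i} \<and> j \<notin> S. D i j S)
          = (\<Sum>j\<in>U - {i}. \<Sum>S | S \<in> ?\<S> \<and> j \<notin> S. D i j S)"
          using fin by (intro sum.swap_restrict) auto
        have "0 = (\<Sum>S\<in>?\<S>. A i + (\<Sum>j\<in>U - S - {i}. D i j S))"
          using merge[OF i] s by (intro sum.neutral[symmetric]) auto
        also have "\<dots> = real (card ?\<S>) * A i + (\<Sum>S\<in>?\<S>. \<Sum>j\<in>U - S - {i}. D i j S)"
          by (simp add: sum.distrib)
        also have "(\<Sum>S\<in>?\<S>. \<Sum>j\<in>U - S - {i}. D i j S)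
          = (\<Sum>S\<in>?\<S>. \<Sum>j | j \<in> U - {i} \<and> j \<notin> S. D i j S)"
          by (intro sum.cong) auto
        also note sw
        also have "(\<Sum>j\<in>U - {i}. \<Sum>S | S \<in> ?\<S> \<and> j \<notin> S. D i j S)
          = (\<Sum>j\<in>U - {i}. \<Sum>S | S \<subseteq> U - {i, j} \<and> card S = s. D i j S)"
          by (intro sum.cong) auto
        finally show ?thesis using c by simp
      qed
      then have "(\<Sum>i\<in>U. real ((m - 1) choose s) * A i
        + (\<Sum>j\<in>U - {i}. \<Sum>S | S \<subseteq> U - {i, j} \<and> card S = s. D i j S)) = 0"
        by (intro sum.neutral) auto
      then show ?thesis by (simp add: X_def sum.distrib sum_distrib_left)
    qed
    have X_flip: "X s = - X (m - 2 - s)" if s: "s \<le> m - 2" for s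
    proof -
      have eq: "(\<Sum>S | S \<subseteq> U - {i, j} \<and> card S = s. D i j S)
        = (\<Sum>S | S \<subseteq> U - {i, j} \<and> card S = m - 2 - s. - D j i S)"
        if ij: "i \<in> U" "j \<in> U" "i \<noteq> j" for i j
      proof (rule sum.reindex_bij_witness[where i = "\<lambda>S. U - {i, j} - S" and j = "\<lambda>S. U - {i, j} - S"])
        have c: "card (U - {i, j}) = m - 2"
          using ij fin by (simp add: m_def card_Diff_subset)
        have cS: "card (U - {i, j} - S) = m - 2 - card S" if "S \<subseteq> U - {i, j}" for S
          using that fin c by (metis card_Diff_subset finite_Diff finite_subset)
        show "U - {i, j} - S \<in> {S. S \<subseteq> U - {i, j} \<and> card S = m - 2 - s}"
          if "S \<in> {S. S \<subseteq> U - {i, j} \<and> card S = s}" for S using that cS by auto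
        show "U - {i, j} - S \<in> {S. S \<subseteq> U - {i, j} \<and> card S = s}"
          if "S \<in> {S. S \<subseteq> U - {i, j} \<and> card S = m - 2 - s}" for S using that cS s by auto
        show "- D j i (U - {i, j} - S) = D i j S"
          if "S \<in> {S. S \<subseteq> U - {i, j} \<and> card S = s}" for S using that D_flip[OF ij] by simp
      qed auto
      have "X s = (\<Sum>i\<in>U. \<Sum>j\<in>U - {i}. \<Sum>S | S \<subseteq> U - {i, j} \<and> card S = m - 2 - s. - D j i S)"
        unfolding X_def by (rule sum.cong[OF refl], rule sum.cong[OF refl], rule eq) auto
      also have "\<dots> = - (\<Sum>i\<in>U. \<Sum>j | j \<in> U \<and> i \<noteq> j.
          \<Sum>S | S \<subseteq> U - {i, j} \<and> card S = m - 2 - s. D j i S)"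
        unfolding sum_negf by (intro arg_cong[of _ _ uminus] sum.cong) auto
      also have "(\<Sum>i\<in>U. \<Sum>j | j \<in> U \<and> i \<noteq> j. \<Sum>S | S \<subseteq> U - {i, j} \<and> card S = m - 2 - s. D j i S)
        = (\<Sum>j\<in>U. \<Sum>i | i \<in> U \<and> i \<noteq> j. \<Sum>S | S \<subseteq> U - {i, j} \<and> card S = m - 2 - s. D j i S)"
        using fin by (rule sum.swap_restrict) (rule fin)
      also have "\<dots> = X (m - 2 - s)"
        unfolding X_def by (intro sum.cong) auto
      finally show ?thesis .
    qed
    \<comment> \<open>Both sizes are admissible in \<open>rel\<close> because
      \<open>4 \<le> m\<close>. For \<open>m = 4\<close> they coincide and \<open>X 1\<close> is
      zero. Adding the two relations leaves a positive multiple of the wanted sum.\<close>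
    have "X (m - 3) = - X 1" using X_flip[of 1] 3 by (simp add: numeral_3_eq_3)
    then have "real ((m - 1) choose 1) * (\<Sum>i\<in>U. A i) + real ((m - 1) choose (m - 3)) * (\<Sum>i\<in>U. A i) = 0"
      using rel[of 1] rel[of "m - 3"] 3 by simp
    then have "(real (m - 1) + real ((m - 1) choose (m - 3))) * (\<Sum>i\<in>U. A i) = 0"
      by (simp add: algebra_simps)
    moreover have "0 < real (m - 1) + real ((m - 1) choose (m - 3))"
      using 3 by (intro add_pos_nonneg) auto
    ultimately show ?thesis by (simp add: A_def)
  qed
qed


text \<open>For \<open>p = r\<close> this is \<open>star_sum\<close> with the arc between
  \<open>r\<close> and \<open>j\<close> reversed in every summand with centre \<open>j\<close> in
  \<open>U\<close>. For a deeper \<open>p\<close> the root \<open>r\<close> is moved one step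
  towards \<open>p\<close>; by \<open>flip\<close> both sides change sign.\<close>

lemma star_sum_below:
  assumes "rooted_forest V (insert r U) F" "r \<notin> U" "U \<noteq> {}" "(p, r) \<in> F ^^ n"
  shows "\<beta> V (F \<union> U \<times> {p}) = (\<Sum>j\<in>U. \<beta> V (insert (j, p) (F \<union> (U - {j}) \<times> {j})))"
  using assms
proof (induction n arbitrary: r F)
  case 0
  note F = \<open>rooted_forest V (insert r U) F\<close>
  have fin: "finite U" using rooted_forestD(7)[OF F] by simp
  then have "0 < card U" using \<open>U \<noteq> {}\<close> by (simp add: card_gt_0_iff)
  then have "2 \<le> card (insert r U)" using fin \<open>r \<notin> U\<close> by simp
  then have "(\<Sum>c\<in>insert r U. \<beta> V (F \<union> (insert r U - {c}) \<times> {c})) = 0"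
    using star_sum[OF F] by blast
  then have "\<beta> V (F \<union> U \<times> {r}) = - (\<Sum>j\<in>U. \<beta> V (F \<union> (insert r U - {j}) \<times> {j}))"
    using fin \<open>r \<notin> U\<close> by simp
  also have "\<dots> = (\<Sum>j\<in>U. \<beta> V (insert (j, r) (F \<union> (U - {j}) \<times> {j})))"
    unfolding sum_negf[symmetric]
  proof (rule sum.cong[OF refl])
    fix j assume j: "j \<in> U"
    have ne: "j \<noteq> r" using j \<open>r \<notin> U\<close> by blast
    let ?F = "F \<union> (U - {j}) \<times> {j}"
    have "rooted_forest V (insert r U - (U - {j})) ?F"
      by (rule rooted_forest_join_root[OF F]) (use j in auto)
    moreover have "insert r U - (U - {j}) = {j, r}" using j \<open>r \<notin> U\<close> by auto
    ultimately have "\<beta> V (insert (j, r) ?F) = - \<beta> V (insert (r, j) ?F)"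
      using flip ne by simp
    moreover have "insert (r, j) ?F = F \<union> (insert r U - {j}) \<times> {j}" using ne by auto
    ultimately show "- \<beta> V (F \<union> (insert r U - {j}) \<times> {j}) = \<beta> V (insert (j, r) ?F)" by simp
  qed
  finally show ?case using 0 by simp
next
  case (Suc n)
  note F = \<open>rooted_forest V (insert r U) F\<close>
  obtain q where q: "(p, q) \<in> F ^^ n" "(q, r) \<in> F"
    using \<open>(p, r) \<in> F ^^ Suc n\<close> by auto
  have qU: "q \<notin> U" "q \<noteq> r"
    using rooted_forest_root_noarc[OF F, of q] q(2) by auto
  \<comment> \<open>Without the edge between \<open>q\<close> and \<open>r\<close>, its two
    orientations can be inserted into the same forest and compared by \<open>flip\<close>. Inserting
    \<open>(r, q)\<close> makes \<open>q\<close> the root and shortens the path from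
    \<open>p\<close> by one.\<close>
  define F0 where "F0 = F - {(q, r)}"
  have F0: "rooted_forest V (insert q (insert r U)) F0"
    unfolding F0_def by (rule rooted_forest_remove_arc[OF F q(2)])
  have path0: "(p, q) \<in> F0 ^^ n"
    unfolding F0_def by (rule relpow_avoid_arc[OF rooted_forestD(4)[OF F] q(2,1)])
  then have pq: "(p, q) \<in> F0\<^sup>*" by (rule relpow_imp_rtrancl)
  let ?F1 = "insert (r, q) F0"
  have "rooted_forest V (insert q (insert r U) - {r}) ?F1"
    by (rule rooted_forest_insert_root[OF F0]) (use qU in auto)
  moreover have "insert q (insert r U) - {r} = insert q U" using qU \<open>r \<notin> U\<close> by auto
  ultimately have F1: "rooted_forest V (insert q U) ?F1" by simp
  have path1: "(p, q) \<in> ?F1 ^^ n"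
    using path0 relpow_subset_mono[of F0 ?F1 n] by blast
  have fl: "\<beta> V (insert (q, r) G) = - \<beta> V (insert (r, q) G)"
    if "rooted_forest V {q, r} G" for G
    using flip[OF that qU(2)] .
  have F: "F = insert (q, r) F0" using q(2) by (auto simp: F0_def)
  have "rooted_forest V (insert q (insert r U) - U) (F0 \<union> U \<times> {p})"
    by (rule rooted_forest_join[OF F0 _ pq]) (use qU in auto)
  moreover have "insert q (insert r U) - U = {q, r}" using qU \<open>r \<notin> U\<close> by auto
  ultimately have "\<beta> V (insert (q, r) (F0 \<union> U \<times> {p})) = - \<beta> V (insert (r, q) (F0 \<union> U \<times> {p}))"
    using fl by simp
  then have "\<beta> V (F \<union> U \<times> {p}) = - \<beta> V (?F1 \<union> U \<times> {p})"
    by (simp add: F)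
  also have "\<dots> = - (\<Sum>j\<in>U. \<beta> V (insert (j, p) (?F1 \<union> (U - {j}) \<times> {j})))"
    using Suc.IH[OF F1 qU(1) \<open>U \<noteq> {}\<close> path1] by simp
  also have "\<dots> = (\<Sum>j\<in>U. \<beta> V (insert (j, p) (F \<union> (U - {j}) \<times> {j})))"
    unfolding sum_negf[symmetric]
  proof (rule sum.cong[OF refl])
    fix j assume j: "j \<in> U"
    let ?G = "F0 \<union> (U - {j}) \<times> {j}"
    have "rooted_forest V (insert q (insert r U) - (U - {j})) ?G"
      by (rule rooted_forest_join_root[OF F0]) (use j in auto)
    moreover have "insert q (insert r U) - (U - {j}) = {q, r, j}" using j qU \<open>r \<notin> U\<close> by auto
    ultimately have G: "rooted_forest V {q, r, j} ?G" by simp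
    have pq': "(p, q) \<in> ?G\<^sup>*" using pq by (meson rtrancl_mono subsetD Un_upper1)
    have "rooted_forest V ({q, r, j} - {j}) (?G \<union> {j} \<times> {p})"
      by (rule rooted_forest_join[OF G _ pq']) (use j qU in auto)
    moreover have "{q, r, j} - {j} = {q, r}" using j qU \<open>r \<notin> U\<close> by auto
    moreover have "?G \<union> {j} \<times> {p} = insert (j, p) ?G" by auto
    ultimately have "\<beta> V (insert (q, r) (insert (j, p) ?G)) = - \<beta> V (insert (r, q) (insert (j, p) ?G))"
      using fl by (simp only:)
    then show "- \<beta> V (insert (j, p) (?F1 \<union> (U - {j}) \<times> {j}))
        = \<beta> V (insert (j, p) (F \<union> (U - {j}) \<times> {j}))"
      by (simp add: F insert_commute)
  qed
  finally show ?case .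
qed

end


section \<open>Contracting an edge\<close>

text \<open>The edge from \<open>w\<close> to its parent is contracted and the resulting vertex gets the name of the
  parent.\<close>

definition contract :: "'a rel \<Rightarrow> 'a \<Rightarrow> 'a rel" where
  "contract T w = {(x, y) \<in> T. x \<noteq> w \<and> y \<noteq> w} \<union> {(x, y). (x, w) \<in> T \<and> (w, y) \<in> T}"

text \<open>Each arc of the contraction is a path of one or two arcs of \<open>T\<close>, so
  acyclicity is inherited from \<open>T\<^sup>+\<close>. A vertex whose parent was \<open>w\<close>
  gets the parent of \<open>w\<close>, which exists because \<open>w\<close> is not the
  root.\<close>

lemma rooted_forest_contract:
  assumes T: "rooted_forest V {r} T" and w: "w \<in> V" "w \<noteq> r"
  shows "rooted_forest (V - {w}) {r} (contract T w)"
proof -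
  have "contract T w \<subseteq> T\<^sup>+" by (auto simp: contract_def intro: trancl_into_trancl)
  moreover have "acyclic (T\<^sup>+)" using rooted_forestD(4)[OF T] by (simp add: acyclic_def)
  ultimately have "acyclic (contract T w)" using acyclic_subset by blast
  moreover have "single_valued (contract T w)"
    using rooted_forestD(3)[OF T] by (auto simp: contract_def single_valued_def)
  moreover have "contract T w \<subseteq> (V - {w}) \<times> (V - {w})"
    using rooted_forestD(2)[OF T] rooted_forest_not_loop[OF T] by (auto simp: contract_def)
  moreover have "(V - {w}) - Domain (contract T w) = {r}"
  proof -
    have dom: "Domain T = V - {r}"
      using rooted_forestD(2,5,6)[OF T] by blast
    obtain p where p: "(w, p) \<in> T" using dom w by blast
    have "x \<in> Domain (contract T w)" if "x \<in> V" "x \<noteq> w" "x \<noteq> r" for x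
    proof -
      obtain y where "(x, y) \<in> T" using dom \<open>x \<in> V\<close> \<open>x \<noteq> r\<close> by blast
      then show ?thesis using p \<open>x \<noteq> w\<close> by (cases "y = w") (auto simp: contract_def)
    qed
    moreover have "r \<notin> Domain (contract T w)"
      using rooted_forest_root_noarc[OF T] by (auto simp: contract_def)
    moreover have "r \<in> V" using rooted_forestD(6)[OF T] by blast
    ultimately show ?thesis using w by blast
  qed
  ultimately show ?thesis using rooted_forestD(1)[OF T] by (simp add: rooted_forest_def)
qed

text \<open>This is the forest to which the star relations are applied: \<open>star_sum\<close> if
  \<open>w\<close> is the root, \<open>star_sum_below\<close> otherwise.\<close>

lemma rooted_forest_remove_vertex:
  assumes T: "rooted_forest V {r} T" and w: "w \<in> V"
  shows "rooted_forest (V - {w}) ({u. (u, w) \<in> T} \<union> ({r} - {w})) {(x, y) \<in> T. x \<noteq> w \<and> y \<noteq> w}"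
    (is "rooted_forest _ _ ?F")
proof -
  have "acyclic ?F" using rooted_forestD(4)[OF T] by (rule acyclic_subset) auto
  moreover have "single_valued ?F" using rooted_forestD(3)[OF T] by (rule single_valued_subset[rotated]) auto
  moreover have "?F \<subseteq> (V - {w}) \<times> (V - {w})" using rooted_forestD(2)[OF T] by auto
  moreover have "(V - {w}) - Domain ?F = {u. (u, w) \<in> T} \<union> ({r} - {w})"
  proof -
    have "x \<in> Domain ?F" if "x \<in> V" "x \<noteq> w" "x \<noteq> r" "(x, w) \<notin> T" for x
    proof -
      have "x \<in> Domain T" using rooted_forestD(5)[OF T] that by blast
      then show ?thesis using that by auto
    qed
    moreover have "x \<notin> Domain ?F" if "(x, w) \<in> T" for x
      using rooted_forestD(3)[OF T] that by (auto simp: single_valued_def)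
    moreover have "r \<notin> Domain ?F" "r \<in> V"
      using rooted_forest_root_noarc[OF T] rooted_forestD(6)[OF T] by auto
    moreover have "x \<in> V" "x \<noteq> w" if "(x, w) \<in> T" for x
      using that rooted_forestD(2)[OF T] rooted_forest_not_loop[OF T] by auto
    ultimately show ?thesis by blast
  qed
  ultimately show ?thesis using rooted_forestD(1)[OF T] by (simp add: rooted_forest_def)
qed

section \<open>The flow of contraction values towards the root\<close>

context cycle_sum_zero
begin

text \<open>The contraction of the edge from \<open>u\<close> to \<open>w\<close>, with the resulting vertex named \<open>u\<close>.\<close>

lemma contract_child:
  assumes T: "rooted_forest V {r} T" and u: "(u, w) \<in> T"
  shows "\<beta> (V - {u}) (contract T u) =
    \<beta> (V - {w}) ({(x, y) \<in> T. x \<noteq> w \<and> y \<noteq> w} \<union> ({x. (x, w) \<in> T} - {u}) \<times> {u}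
      \<union> {(x, y). x = u \<and> (w, y) \<in> T})"
    (is "_ = \<beta> _ ?G")
proof -
  note sub = rooted_forestD(2)[OF T] and sv = rooted_forestD(3)[OF T]
  have uw: "u \<noteq> w" "u \<in> V" "w \<in> V" using u sub rooted_forest_not_loop[OF T] by auto
  have wu: "(w, u) \<notin> T"
    using rooted_forestD(4)[OF T] u by (meson acyclic_def r_into_trancl trancl_into_trancl)
  have ur: "u \<noteq> r" using rooted_forest_root_noarc[OF T] u by blast
  have loop: "(x, x) \<notin> T" for x using rooted_forest_not_loop[OF T] .
  \<comment> \<open>\<open>contract\<close> calls the merged vertex \<open>w\<close>. Renaming it to
    \<open>u\<close> puts the contractions for all children \<open>u\<close> of \<open>w\<close> on
    the common vertex set \<open>V - {w}\<close>, where they can be compared.\<close>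
  let ?\<phi> = "\<lambda>x. if x = w then u else x"
  have rf: "rooted_forest (V - {u}) {r} (contract T u)"
    using rooted_forest_contract[OF T] uw ur by blast
  have "inj_on ?\<phi> (V - {u})" by (auto simp: inj_on_def)
  then have "\<beta> (?\<phi> ` (V - {u})) (map_prod ?\<phi> ?\<phi> ` contract T u) = \<beta> (V - {u}) (contract T u)"
    by (rule relabel[OF rf])
  moreover have "?\<phi> ` (V - {u}) = V - {w}"
    using uw by (auto simp: image_iff)
  moreover have "map_prod ?\<phi> ?\<phi> ` contract T u = ?G"
  proof
    have "(?\<phi> x, ?\<phi> y) \<in> ?G" if xy: "(x, y) \<in> contract T u" for x y
    proof -
      consider "(x, y) \<in> T" "x \<noteq> u" "y \<noteq> u" | "(x, u) \<in> T" "(u, y) \<in> T"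
        using xy by (auto simp: contract_def)
      then show ?thesis
      proof cases
        case 1
        then show ?thesis using loop uw by (cases "x = w"; cases "y = w") auto
      next
        case 2
        then have "y = w" "x \<noteq> w" "x \<noteq> u" using u sv wu loop by (auto simp: single_valued_def)
        then show ?thesis using 2 uw by simp
      qed
    qed
    then show "map_prod ?\<phi> ?\<phi> ` contract T u \<subseteq> ?G" by (simp add: image_subset_iff split_paired_all)
    have "(x, y) \<in> map_prod ?\<phi> ?\<phi> ` contract T u" if "(x, y) \<in> T" "x \<noteq> w" "y \<noteq> w" for x y
    proof (cases "y = u")
      case True
      then have "(x, w) \<in> contract T u" using that u by (auto simp: contract_def)
      then have "map_prod ?\<phi> ?\<phi> (x, w) \<in> map_prod ?\<phi> ?\<phi> ` contract T u" by (rule imageI)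
      then show ?thesis using True that by simp
    next
      case False
      moreover have "x \<noteq> u" using that u sv by (auto simp: single_valued_def)
      ultimately have "(x, y) \<in> contract T u" using that by (auto simp: contract_def)
      then have "map_prod ?\<phi> ?\<phi> (x, y) \<in> map_prod ?\<phi> ?\<phi> ` contract T u" by (rule imageI)
      then show ?thesis using that by simp
    qed
    moreover have "(x, u) \<in> map_prod ?\<phi> ?\<phi> ` contract T u" if "(x, w) \<in> T" "x \<noteq> u" for x
    proof -
      have "(x, w) \<in> contract T u" using that uw by (auto simp: contract_def)
      then have "map_prod ?\<phi> ?\<phi> (x, w) \<in> map_prod ?\<phi> ?\<phi> ` contract T u" by (rule imageI)
      moreover have "x \<noteq> w" using that loop by blast
      ultimately show ?thesis by simp
    qed
    moreover have "(u, y) \<in> map_prod ?\<phi> ?\<phi> ` contract T u" if "(w, y) \<in> T" for y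
    proof -
      have "(w, y) \<in> contract T u" using that uw wu by (auto simp: contract_def)
      then have "map_prod ?\<phi> ?\<phi> (w, y) \<in> map_prod ?\<phi> ?\<phi> ` contract T u" by (rule imageI)
      moreover have "y \<noteq> w" using that loop by blast
      ultimately show ?thesis by simp
    qed
    ultimately show "?G \<subseteq> map_prod ?\<phi> ?\<phi> ` contract T u" by auto
  qed
  ultimately show ?thesis by simp
qed

text \<open>Contracting the edge from \<open>u\<close> to the root hangs the other children of the
  root on \<open>u\<close>. The summands therefore form a star sum over the forest left by deleting
  \<open>r\<close>.\<close>

lemma contract_sum_root:
  assumes T: "rooted_forest V {r} T" and "2 \<le> card {u. (u, r) \<in> T}"
  shows "(\<Sum>u | (u, r) \<in> T. \<beta> (V - {u}) (contract T u)) = 0"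
proof -
  let ?N = "{u. (u, r) \<in> T}"
  have r: "r \<in> V" using rooted_forestD(6)[OF T] by blast
  have noarc: "(r, y) \<notin> T" for y using rooted_forest_root_noarc[OF T] by blast
  have "rooted_forest (V - {r}) ?N {(x, y) \<in> T. x \<noteq> r \<and> y \<noteq> r}"
    using rooted_forest_remove_vertex[OF T r] by simp
  from star_sum[OF this assms(2)] show ?thesis
    using contract_child[OF T] noarc by simp
qed

text \<open>This is the conservation of the flow at an inner vertex. After deletion of
  \<open>w\<close> its parent \<open>p\<close> stays in the tree of \<open>r\<close>. Contracting
  the edge above \<open>w\<close> hangs all children of \<open>w\<close> on \<open>p\<close>;
  contracting the edge from a child \<open>u\<close> hangs the other children on \<open>u\<close>
  and \<open>u\<close> on \<open>p\<close>. These are the two sides of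
  \<open>star_sum_below\<close>.\<close>

lemma contract_sum_nonroot:
  assumes T: "rooted_forest V {r} T" and w: "w \<in> Range T" "w \<noteq> r"
  shows "\<beta> (V - {w}) (contract T w) = (\<Sum>u | (u, w) \<in> T. \<beta> (V - {u}) (contract T u))"
proof -
  let ?N = "{u. (u, w) \<in> T}" and ?F = "{(x, y) \<in> T. x \<noteq> w \<and> y \<noteq> w}"
  note sub = rooted_forestD(2)[OF T] and sv = rooted_forestD(3)[OF T]
  have wV: "w \<in> V" using w sub by auto
  then obtain p where p: "(w, p) \<in> T" using w rooted_forestD(5)[OF T] by blast
  have p_only: "(w, y) \<in> T \<longleftrightarrow> y = p" for y using p sv by (auto simp: single_valued_def)
  have pw: "p \<noteq> w" using p rooted_forest_not_loop[OF T] by blast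
  have F: "rooted_forest (V - {w}) (insert r ?N) ?F"
    using rooted_forest_remove_vertex[OF T wV] w(2) by (simp add: insert_Diff_if)
  have rN: "r \<notin> ?N" using rooted_forest_root_noarc[OF T] by blast
  have "p \<in> V - {w}" using p sub pw by auto
  then obtain s where s: "s \<in> insert r ?N" "(p, s) \<in> ?F\<^sup>*"
    using rooted_forest_ex_root[OF F] by blast
  have "s = r"
  proof (rule ccontr)
    assume "s \<noteq> r"
    then have "(s, w) \<in> T" using s(1) by blast
    moreover have "(p, s) \<in> T\<^sup>*" using s(2) rtrancl_mono[of ?F T] by auto
    ultimately have "(w, w) \<in> T\<^sup>+"
      using p by (meson rtrancl_into_trancl1 trancl_into_trancl2)
    then show False using rooted_forestD(4)[OF T] by (auto simp: acyclic_def)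
  qed
  then obtain n where n: "(p, r) \<in> ?F ^^ n" using rtrancl_imp_relpow[OF s(2)] by blast
  have "?N \<noteq> {}" using w(1) by blast
  from star_sum_below[OF F rN this n]
  have "\<beta> (V - {w}) (?F \<union> ?N \<times> {p})
    = (\<Sum>j\<in>?N. \<beta> (V - {w}) (insert (j, p) (?F \<union> (?N - {j}) \<times> {j})))" .
  moreover have "contract T w = ?F \<union> ?N \<times> {p}"
    by (auto simp: contract_def p_only)
  moreover have "\<beta> (V - {u}) (contract T u) = \<beta> (V - {w}) (insert (u, p) (?F \<union> (?N - {u}) \<times> {u}))"
    if "u \<in> ?N" for u
  proof -
    have "{(x, y). x = u \<and> (w, y) \<in> T} = {(u, p)}" by (auto simp: p_only)
    then show ?thesis using contract_child[OF T, of u w] that by simp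
  qed
  ultimately show ?thesis by simp
qed

text \<open>Group the edges by their parent vertex. The group at the root sums to zero and the group
  at an inner vertex \<open>w\<close> sums to the value of the edge above \<open>w\<close>. Hence
  the sum over all edges equals the sum over those above inner vertices, and the edges above leaves
  contribute zero.\<close>

lemma contract_sum_leaves:
  assumes T: "rooted_forest V {r} T" and c: "2 \<le> card {u. (u, r) \<in> T}"
  shows "(\<Sum>l\<in>V - Range T. \<beta> (V - {l}) (contract T l)) = 0"
proof -
  define B where "B w = \<beta> (V - {w}) (contract T w)" for w
  note sub = rooted_forestD(2)[OF T] and sv = rooted_forestD(3)[OF T]
  have fin: "finite V" "finite (Range T)"
    using rooted_forestD(1,8)[OF T] by (auto intro: finite_Range)
  have dom: "Domain T = V - {r}" using rooted_forestD(2,5,6)[OF T] by blast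
  have rR: "r \<in> Range T"
  proof (rule ccontr)
    assume "r \<notin> Range T"
    then have "{u. (u, r) \<in> T} = {}" by blast
    then show False using c by simp
  qed
  have RV: "Range T \<subseteq> V" using sub by auto
  have fib: "finite {u. (u, w) \<in> T}" for w
    by (rule finite_subset[OF _ fin(1)]) (use sub in auto)
  have "V - {r} = (\<Union>w\<in>Range T. {u. (u, w) \<in> T})" using dom by auto
  moreover have "{u. (u, w) \<in> T} \<inter> {u. (u, x) \<in> T} = {}" if "w \<noteq> x" for w x
    using that sv by (auto simp: single_valued_def)
  ultimately have "(\<Sum>u\<in>V - {r}. B u) = (\<Sum>w\<in>Range T. \<Sum>u | (u, w) \<in> T. B u)"
    using fin fib by (simp only:) (rule sum.UNION_disjoint, auto)
  also have "\<dots> = (\<Sum>u | (u, r) \<in> T. B u) + (\<Sum>w\<in>Range T - {r}. \<Sum>u | (u, w) \<in> T. B u)"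
    using fin rR by (simp add: sum.remove)
  also have "\<dots> = (\<Sum>w\<in>Range T - {r}. B w)"
    using contract_sum_root[OF T c] contract_sum_nonroot[OF T] by (simp add: B_def)
  finally have "(\<Sum>u\<in>V - {r}. B u) = (\<Sum>w\<in>Range T - {r}. B w)" .
  moreover have "V - {r} = (Range T - {r}) \<union> (V - Range T)" using RV rR by auto
  then have "(\<Sum>u\<in>V - {r}. B u) = (\<Sum>w\<in>Range T - {r}. B w) + (\<Sum>l\<in>V - Range T. B l)"
    using fin by (simp add: sum.union_disjoint[symmetric] disjoint_iff)
  ultimately show ?thesis by (simp add: B_def)
qed

text \<open>The induction decreases the number of vertices minus the number of children of the root.
  An infinite vertex type provides the name of the additional leaf.\<close>

lemma cycle_sum_zero_vanish:
  assumes inf: "infinite (UNIV :: 'a set)"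
    and "rooted_forest V {r} F" "2 \<le> card V"
  shows "\<beta> V F = 0"
  using assms(2-)
proof (induction "card V - card {u. (u, r) \<in> F}" arbitrary: V F rule: less_induct)
  case less
  note F = less.prems(1)
  have fin: "finite V" by (rule rooted_forestD(1)[OF F])
  have rV: "r \<in> V" using rooted_forestD(6)[OF F] by blast
  have noarc: "(r, x) \<notin> F" for x using rooted_forest_root_noarc[OF F] by blast
  note sub = rooted_forestD(2)[OF F] and sv = rooted_forestD(3)[OF F]
  obtain l where l: "l \<notin> V" using ex_new_if_finite[OF inf fin] by blast
  have lF: "(l, x) \<notin> F" "(x, l) \<notin> F" for x using sub l by auto
  have lr: "l \<noteq> r" using l rV by blast
  let ?V = "insert l V" and ?T = "insert (l, r) F"
  let ?N = "{u. (u, r) \<in> F}"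
  have finN: "finite ?N" by (rule finite_subset[OF _ fin]) (use sub in auto)
  have "rooted_forest ?V {l, r} F"
    using rooted_forestD[OF F] lF by (auto simp: rooted_forest_def)
  then have "rooted_forest ?V ({l, r} - {l}) ?T"
    by (rule rooted_forest_insert_root) (use lr in auto)
  moreover have "{l, r} - {l} = {r}" using lr by auto
  ultimately have T: "rooted_forest ?V {r} ?T" by simp
  \<comment> \<open>The root has a child since there are at least two vertices. Together with the
    new leaf \<open>l\<close> it has two in \<open>?T\<close>, as \<open>contract_sum_leaves\<close>
    requires.\<close>
  have "?N \<noteq> {}"
  proof
    assume N: "?N = {}"
    have "\<not> V \<subseteq> {r}" using less.prems(2) card_mono[of "{r}" V] by auto
    then obtain x where x: "x \<in> V" "x \<noteq> r" by blast
    obtain u where "u \<in> {r}" "(x, u) \<in> F\<^sup>*" using rooted_forest_ex_root[OF F x(1)] by blast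
    then have "(x, r) \<in> F\<^sup>*" by blast
    then show False using x(2) N by (metis empty_Collect_eq rtranclE)
  qed
  then have "card ?N \<noteq> 0" using finN by simp
  have NT: "{u. (u, r) \<in> ?T} = insert l ?N" by auto
  have cNT: "card {u. (u, r) \<in> ?T} = Suc (card ?N)"
    unfolding NT using finN lF by simp
  have "card ?N < card V"
    by (rule psubset_card_mono[OF fin]) (use sub rV noarc in auto)
  have "(\<Sum>x\<in>?V - Range ?T. \<beta> (?V - {x}) (contract ?T x)) = 0"
    by (rule contract_sum_leaves[OF T]) (use cNT \<open>card ?N \<noteq> 0\<close> in simp)
  moreover have "\<beta> (?V - {x}) (contract ?T x) = (if (x, r) \<in> ?T then \<beta> V F else 0)"
    if x: "x \<in> ?V - Range ?T" for x
  proof (cases "(x, r) \<in> ?T")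
    case True
    \<comment> \<open>Contracting a leaf at the root just deletes it. What remains is
      \<open>F\<close> with \<open>x\<close> replaced by \<open>l\<close>, which is also a leaf at
      the root.\<close>
    let ?\<phi> = "\<lambda>y. if y = x then l else y"
    have leaf: "(y, x) \<notin> F" for y using x by auto
    have only: "(x, y) \<in> F \<Longrightarrow> y = r" for y
      using True sv lF by (auto simp: single_valued_def)
    have "inj_on ?\<phi> V" using l by (auto simp: inj_on_def)
    then have "\<beta> (?\<phi> ` V) (map_prod ?\<phi> ?\<phi> ` F) = \<beta> V F" by (rule relabel[OF F])
    moreover have "?\<phi> ` V = ?V - {x}" using x l by (auto simp: image_iff)
    moreover have "map_prod ?\<phi> ?\<phi> ` F = contract ?T x"
    proof
      have "(?\<phi> y, ?\<phi> z) \<in> contract ?T x" if yz: "(y, z) \<in> F" for y z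
      proof (cases "y = x")
        case True
        then have "z = r" "x \<noteq> l" using only yz lF by auto
        then show ?thesis using True x by (auto simp: contract_def)
      next
        case False
        moreover have "z \<noteq> x" using leaf yz by blast
        ultimately show ?thesis using yz by (auto simp: contract_def)
      qed
      then show "map_prod ?\<phi> ?\<phi> ` F \<subseteq> contract ?T x" by (simp add: image_subset_iff split_paired_all)
      show "contract ?T x \<subseteq> map_prod ?\<phi> ?\<phi> ` F"
      proof
        fix e assume "e \<in> contract ?T x"
        then have e: "e \<in> ?T" "fst e \<noteq> x" "snd e \<noteq> x"
          using leaf x by (auto simp: contract_def)
        show "e \<in> map_prod ?\<phi> ?\<phi> ` F"
        proof (cases "e = (l, r)")
          case True
          then have "(x, r) \<in> F" using e \<open>(x, r) \<in> ?T\<close> by auto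
          then have "map_prod ?\<phi> ?\<phi> (x, r) \<in> map_prod ?\<phi> ?\<phi> ` F" by (rule imageI)
          then show ?thesis using True e by simp
        next
          case False
          then have "e \<in> F" using e by blast
          then have "map_prod ?\<phi> ?\<phi> e \<in> map_prod ?\<phi> ?\<phi> ` F" by (rule imageI)
          then show ?thesis using e by (simp add: map_prod_def split_beta)
        qed
      qed
    qed
    ultimately have "\<beta> (?V - {x}) (contract ?T x) = \<beta> V F" by (simp only:)
    then show ?thesis using True by (simp only: if_True)
  next
    case False
    then have xl: "x \<noteq> l" "x \<in> V" "x \<noteq> r" using x by auto
    have leaf: "(y, x) \<notin> ?T" for y using x by auto
    \<comment> \<open>A leaf away from the root leaves the children of the root untouched, so
      \<open>l\<close> remains as an additional child on equally many vertices and the induction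
      hypothesis applies.\<close>
    have "rooted_forest (?V - {x}) {r} (contract ?T x)"
      using rooted_forest_contract[OF T] xl by blast
    moreover have "card (?V - {x}) = card V" using xl fin l by simp
    moreover have "{u. (u, r) \<in> contract ?T x} = {u. (u, r) \<in> ?T}"
      using False leaf xl by (auto simp: contract_def)
    ultimately have "\<beta> (?V - {x}) (contract ?T x) = 0"
      using less.hyps[of "?V - {x}" "contract ?T x"] cNT less.prems(2) \<open>card ?N < card V\<close> by simp
    then show ?thesis using False by simp
  qed
  ultimately have "(\<Sum>x\<in>?V - Range ?T. if (x, r) \<in> ?T then \<beta> V F else 0) = 0" by simp
  then have "real (card {x \<in> ?V - Range ?T. (x, r) \<in> ?T}) * \<beta> V F = 0"
    using fin by (simp add: sum.inter_filter[symmetric])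
  \<comment> \<open>The multiplicity of \<open>\<beta> V F\<close> is not zero because
    \<open>l\<close> itself is one of the leaves counted.\<close>
  moreover have "l \<in> {x \<in> ?V - Range ?T. (x, r) \<in> ?T}" using lF lr by auto
  then have "card {x \<in> ?V - Range ?T. (x, r) \<in> ?T} \<noteq> 0" using fin by auto
  ultimately show ?case by simp
qed

end


section \<open>Rooted trees as rooted forests with one root\<close>

lemma out_degree_eq_0_iff:
  "finite (parcs G) \<Longrightarrow> out_degree (with_proj G) v = 0 \<longleftrightarrow> v \<notin> Domain (parcs G)"
  by (auto simp: out_degree_pair)

lemma out_degree_eq_1_iff:
  "out_degree (with_proj G) v = 1 \<longleftrightarrow> (\<exists>!w. (v, w) \<in> parcs G)"
proof
  assume "out_degree (with_proj G) v = 1"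
  then obtain e where "{e \<in> parcs G. fst e = v} = {e}"
    unfolding out_degree_pair by (auto simp: card_1_singleton_iff)
  then have "e' \<in> parcs G \<and> fst e' = v \<longleftrightarrow> e' = e" for e' by blast
  then show "\<exists>!w. (v, w) \<in> parcs G" by (metis fst_conv prod.collapse snd_conv)
next
  assume "\<exists>!w. (v, w) \<in> parcs G"
  then obtain w where "(v, w) \<in> parcs G" "\<And>w'. (v, w') \<in> parcs G \<Longrightarrow> w' = w" by blast
  then have "e \<in> parcs G \<and> fst e = v \<longleftrightarrow> e = (v, w)" for e by (metis fst_conv prod.collapse)
  then have "{e \<in> parcs G. fst e = v} = {(v, w)}" by simp
  then show "out_degree (with_proj G) v = 1" by (simp add: out_degree_pair)
qed

lemma rooted_forest_imp_rooted_tree: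
  assumes F: "rooted_forest (pverts G) {r} (parcs G)"
  shows "rooted_tree G"
  unfolding rooted_tree_def
proof (intro conjI bexI[of _ r] ballI impI)
  note sub = rooted_forestD(2)[OF F]
  show "pair_fin_digraph G"
    using rooted_forestD(1,2,8)[OF F] by unfold_locales auto
  show r: "r \<in> pverts G" using rooted_forestD(6)[OF F] by blast
  show "out_degree G r = 0"
    using rooted_forestD(5,8)[OF F] by (subst out_degree_eq_0_iff) auto
  fix v assume v: "v \<in> pverts G"
  have "(v, r) \<in> (parcs G)\<^sup>*" using rooted_forest_ex_root[OF F v] by blast
  then have "(v, r) \<in> rtrancl_on (pverts G) (parcs G)"
    by (rule rtrancl_consistent_rtrancl_on) (use v r sub in auto)
  then show "v \<rightarrow>\<^sup>*\<^bsub>with_proj G\<^esub> r" by (simp add: reachable_def)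
  assume "v \<noteq> r"
  then obtain w where "(v, w) \<in> parcs G" using rooted_forestD(5)[OF F] v by blast
  then show "out_degree G v = 1"
    using rooted_forestD(3)[OF F] unfolding out_degree_eq_1_iff by (auto simp: single_valued_def)
qed

lemma rooted_tree_imp_rooted_forest:
  assumes G: "rooted_tree G"
  shows "rooted_forest (pverts G) {root_of G} (parcs G)"
proof -
  interpret pair_fin_digraph G using G by (simp add: rooted_tree_def)
  obtain r where r: "r \<in> pverts G" "out_degree G r = 0"
    "\<And>v. v \<in> pverts G \<Longrightarrow> v \<rightarrow>\<^sup>*\<^bsub>with_proj G\<^esub> r"
    "\<And>v. v \<in> pverts G \<Longrightarrow> v \<noteq> r \<Longrightarrow> out_degree G v = 1"
    using G unfolding rooted_tree_def by blast
  have root: "root_of G = r" using G r by (intro root_of_eqI)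
  have rD: "r \<notin> Domain (parcs G)"
    using r(2) pair_finite_arcs by (simp add: out_degree_eq_0_iff)
  have sub: "parcs G \<subseteq> pverts G \<times> pverts G" using wellformed' by auto
  have ex1: "\<exists>!w. (v, w) \<in> parcs G" if "v \<in> pverts G" "v \<noteq> r" for v
    using r(4)[OF that] by (simp only: out_degree_eq_1_iff)
  have sv: "single_valued (parcs G)"
  proof (rule single_valuedI)
    fix x y z assume xyz: "(x, y) \<in> parcs G" "(x, z) \<in> parcs G"
    then have "x \<in> pverts G" "x \<noteq> r" using sub rD by auto
    then show "y = z" using ex1 xyz by blast
  qed
  have "acyclic (parcs G)"
  proof (rule acyclicI, rule allI, rule notI)
    fix x assume x: "(x, x) \<in> (parcs G)\<^sup>+"
    then have "x \<in> pverts G" using sub by (metis tranclD mem_Sigma_iff subsetD)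
    then have "(x, r) \<in> (parcs G)\<^sup>*"
      using r(3) by (auto simp: reachable_def intro: rtrancl_on_rtranclI)
    \<comment> \<open>Since arcs are single-valued, each arc leaving a vertex on a cycle stays on
      that cycle. The path from \<open>x\<close> to \<open>r\<close> thus carries the cycle to
      \<open>r\<close>, which has no outgoing arc.\<close>
    then have "(r, r) \<in> (parcs G)\<^sup>+"
    proof (induction rule: rtrancl_induct)
      case base
      then show ?case using x .
    next
      case (step y z)
      obtain w where w: "(y, w) \<in> parcs G" "(w, y) \<in> (parcs G)\<^sup>*"
        using tranclD[OF step.IH] by blast
      then have "w = z" using sv step(2) by (auto simp: single_valued_def)
      then show ?case using w step(2) by (meson rtrancl_into_trancl1)
    qed
    then show False using rD by (metis tranclD DomainI)
  qed
  moreover have "pverts G - Domain (parcs G) = {r}"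
    using r(1) rD ex1 by blast
  ultimately show ?thesis
    using sub sv pair_finite_verts by (simp add: rooted_forest_def root)
qed

lemma root_of_rooted_forest:
  assumes "rooted_forest (pverts G) {r} (parcs G)"
  shows "root_of G = r"
  using rooted_forestD(5)[OF assms]
    rooted_forestD(5)[OF rooted_tree_imp_rooted_forest[OF rooted_forest_imp_rooted_tree[OF assms]]]
  by simp


section \<open>Representatives of the isomorphism classes\<close>

lemma abs_rtree_eq_iff:
  assumes "rooted_tree G" "rooted_tree H"
  shows "abs_rtree G = abs_rtree H \<longleftrightarrow> digraph_iso G H"
  using Quotient_rel[OF Quotient_rtree, of G H] assms
    digraph_iso_pair_refl[OF rooted_tree_imp_wf] by auto

lemma abs_tree_cycle_eq_iff:
  assumes "cycle_of_trees G" "cycle_of_trees H"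
  shows "abs_tree_cycle G = abs_tree_cycle H \<longleftrightarrow> digraph_iso G H"
  using Quotient_rel[OF Quotient_tree_cycle, of G H] assms
    digraph_iso_pair_refl[OF cycle_of_trees_imp_wf] by auto

lemma rep_abs_rtree_iso:
  assumes "rooted_tree G"
  shows "digraph_iso (rep_rtree (abs_rtree G)) G"
  using abs_rtree_eq_iff[OF rooted_tree_rep assms] abs_rep_rtree by blast

lemma rep_abs_tree_cycle_iso:
  assumes "cycle_of_trees G"
  shows "cycle_of_trees (rep_tree_cycle (abs_tree_cycle G))"
    "digraph_iso (rep_tree_cycle (abs_tree_cycle G)) G"
  using rep_abs_rsp_left[OF Quotient3_tree_cycle, of G G] assms
    digraph_iso_pair_refl[OF cycle_of_trees_imp_wf] by auto

section \<open>Invariants of the isomorphism classes: size and loops\<close>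

lemma digraph_iso_card_verts:
  fixes G H :: "nat pair_pre_digraph"
  assumes "pair_wf_digraph G" "digraph_iso G H"
  shows "card (pverts G) = card (pverts H)"
  using assms(2) unfolding digraph_iso_pair_iff[OF assms(1)] by (auto simp: card_image)

lemma digraph_iso_loop:
  fixes G H :: "nat pair_pre_digraph"
  assumes "pair_wf_digraph G" "digraph_iso G H"
  shows "(\<exists>v. (v, v) \<in> parcs H) \<longleftrightarrow> (\<exists>v. (v, v) \<in> parcs G)"
proof -
  interpret pair_wf_digraph G by fact
  obtain \<phi> where \<phi>: "inj_on \<phi> (pverts G)" "parcs H = map_prod \<phi> \<phi> ` parcs G"
    using assms(2) unfolding digraph_iso_pair_iff[OF assms(1)] by blast
  have "u = v" if "(u, v) \<in> parcs G" "\<phi> u = \<phi> v" for u v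
    using that \<phi>(1) wellformed'[OF that(1)] by (auto dest: inj_onD)
  then show ?thesis unfolding \<phi>(2) by (auto intro: rev_image_eqI)
qed

lemma num_vertices_abs: "rooted_tree G \<Longrightarrow> num_vertices (abs_rtree G) = card (pverts G)"
  unfolding num_vertices_def
  by (intro digraph_iso_card_verts rep_abs_rtree_iso rooted_tree_imp_wf rooted_tree_rep)

lemma cycle_num_vertices_abs:
  "cycle_of_trees C \<Longrightarrow> cycle_num_vertices (abs_tree_cycle C) = card (pverts C)"
  unfolding cycle_num_vertices_def
  by (intro digraph_iso_card_verts rep_abs_tree_cycle_iso cycle_of_trees_imp_wf)

lemma has_loop_abs:
  assumes "cycle_of_trees C"
  shows "has_loop (abs_tree_cycle C) \<longleftrightarrow> (\<exists>v. (v, v) \<in> parcs C)"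
  unfolding has_loop_def
  using digraph_iso_loop[OF cycle_of_trees_imp_wf] rep_abs_tree_cycle_iso[OF assms] by blast


section \<open>Counting isomorphisms\<close>

text \<open>Extensionality fixes the values outside the vertices, so that each isomorphism is
  counted once, also between graphs on different vertex sets.\<close>

definition isos :: "nat pair_pre_digraph \<Rightarrow> nat pair_pre_digraph \<Rightarrow> (nat \<Rightarrow> nat) set" where
  "isos G H = {\<phi> \<in> extensional (pverts G).
    bij_betw \<phi> (pverts G) (pverts H) \<and> map_prod \<phi> \<phi> ` parcs G = parcs H}"

lemma map_prod_image_cong:
  assumes "A \<subseteq> V \<times> V" "\<And>x. x \<in> V \<Longrightarrow> f x = g x"
  shows "map_prod f f ` A = map_prod g g ` A"
  using assms by (intro image_cong) auto

lemma pair_wf_digraph_subset: "pair_wf_digraph G \<Longrightarrow> parcs G \<subseteq> pverts G \<times> pverts G"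
  using pair_wf_digraph.wellformed' by fastforce

lemma isos_nonempty_iff:
  assumes wf: "pair_wf_digraph G"
  shows "isos G H \<noteq> {} \<longleftrightarrow> digraph_iso G H"
proof
  assume "isos G H \<noteq> {}"
  then obtain \<phi> where "\<phi> \<in> isos G H" by blast
  then show "digraph_iso G H"
    unfolding digraph_iso_pair_iff[OF wf]
    by (intro exI[of _ \<phi>]) (auto simp: isos_def bij_betw_def)
next
  assume "digraph_iso G H"
  then obtain \<phi> where \<phi>: "inj_on \<phi> (pverts G)" "pverts H = \<phi> ` pverts G"
    "parcs H = map_prod \<phi> \<phi> ` parcs G" unfolding digraph_iso_pair_iff[OF wf] by blast
  have "map_prod (restrict \<phi> (pverts G)) (restrict \<phi> (pverts G)) ` parcs G = parcs H"
    unfolding \<phi>(3) by (rule map_prod_image_cong[OF pair_wf_digraph_subset[OF wf]]) simp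
  then have "restrict \<phi> (pverts G) \<in> isos G H"
    using \<phi>(1,2) by (simp add: isos_def bij_betw_def inj_on_restrict_eq)
  then show "isos G H \<noteq> {}" by blast
qed

lemma compose_isos:
  assumes wf: "pair_wf_digraph G" and "\<phi> \<in> isos G H" "\<psi> \<in> isos H K"
  shows "compose (pverts G) \<psi> \<phi> \<in> isos G K"
proof -
  have "map_prod (compose (pverts G) \<psi> \<phi>) (compose (pverts G) \<psi> \<phi>) ` parcs G
      = map_prod (\<psi> \<circ> \<phi>) (\<psi> \<circ> \<phi>) ` parcs G"
    by (rule map_prod_image_cong[OF pair_wf_digraph_subset[OF wf]]) (simp add: compose_def)
  also have "\<dots> = map_prod \<psi> \<psi> ` map_prod \<phi> \<phi> ` parcs G"
    by (simp add: image_comp map_prod.comp)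
  finally show ?thesis using assms(2,3) by (auto simp: isos_def intro: bij_betw_compose)
qed

lemma inverse_isos:
  assumes wf: "pair_wf_digraph G" and \<phi>: "\<phi> \<in> isos G H"
  shows "restrict (inv_into (pverts G) \<phi>) (pverts H) \<in> isos H G" (is "?\<psi> \<in> _")
proof -
  have bij: "bij_betw \<phi> (pverts G) (pverts H)" and arcs: "parcs H = map_prod \<phi> \<phi> ` parcs G"
    using \<phi> by (auto simp: isos_def)
  have inv: "?\<psi> (\<phi> x) = x" if "x \<in> pverts G" for x
    using that bij by (simp add: bij_betw_inv_into_left bij_betw_apply)
  have "map_prod ?\<psi> ?\<psi> ` parcs H = map_prod (\<lambda>x. ?\<psi> (\<phi> x)) (\<lambda>x. ?\<psi> (\<phi> x)) ` parcs G"
    unfolding arcs by (simp only: image_comp map_prod.comp) (simp only: comp_def)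
  also have "\<dots> = map_prod id id ` parcs G"
    by (rule map_prod_image_cong[OF pair_wf_digraph_subset[OF wf]]) (simp only: inv id_apply)
  finally have "map_prod ?\<psi> ?\<psi> ` parcs H = parcs G" by (simp add: map_prod.id)
  moreover have "bij_betw ?\<psi> (pverts H) (pverts G)"
    using bij_betw_inv_into[OF bij] by (simp add: bij_betw_def inj_on_restrict_eq)
  ultimately show ?thesis by (simp add: isos_def)
qed

text \<open>The two sets differ only in the values outside the vertices: fixed points in
  \<open>automorphisms\<close>, the default value in \<open>isos\<close>.\<close>

lemma card_isos_self: "card (isos G G) = card (automorphisms G)" if wf: "pair_wf_digraph G"
proof (rule bij_betw_same_card[symmetric])
  let ?V = "pverts G"
  note sub = pair_wf_digraph_subset[OF wf]
  show "bij_betw (\<lambda>\<pi>. restrict \<pi> ?V) (automorphisms G) (isos G G)"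
  proof (rule bij_betw_byWitness[where f' = "\<lambda>\<phi> x. if x \<in> ?V then \<phi> x else x"])
    show "\<forall>\<pi>\<in>automorphisms G. (\<lambda>x. if x \<in> ?V then restrict \<pi> ?V x else x) = \<pi>"
      by (auto simp: automorphisms_def permutes_def fun_eq_iff)
    show "\<forall>\<phi>\<in>isos G G. restrict (\<lambda>x. if x \<in> ?V then \<phi> x else x) ?V = \<phi>"
      by (auto simp: isos_def extensional_def fun_eq_iff)
    have "restrict \<pi> ?V \<in> isos G G" if "\<pi> \<in> automorphisms G" for \<pi>
    proof -
      have "map_prod (restrict \<pi> ?V) (restrict \<pi> ?V) ` parcs G = map_prod \<pi> \<pi> ` parcs G"
        by (rule map_prod_image_cong[OF sub]) simp
      moreover have "bij_betw \<pi> ?V ?V"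
        using that by (simp add: automorphisms_def permutes_imp_bij)
      ultimately show ?thesis
        using that by (simp add: isos_def automorphisms_def bij_betw_def inj_on_restrict_eq)
    qed
    then show "(\<lambda>\<pi>. restrict \<pi> ?V) ` automorphisms G \<subseteq> isos G G" by blast
    have "(\<lambda>x. if x \<in> ?V then \<phi> x else x) \<in> automorphisms G" (is "?\<pi> \<in> _") if "\<phi> \<in> isos G G" for \<phi>
    proof -
      have "map_prod ?\<pi> ?\<pi> ` parcs G = map_prod \<phi> \<phi> ` parcs G"
        by (rule map_prod_image_cong[OF sub]) simp
      moreover have "bij_betw ?\<pi> ?V ?V \<longleftrightarrow> bij_betw \<phi> ?V ?V"
        by (rule bij_betw_cong) simp
      then have "?\<pi> permutes ?V"
        using that by (intro bij_imp_permutes) (auto simp: isos_def)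
      ultimately show ?thesis using that by (simp add: isos_def automorphisms_def)
    qed
    then show "(\<lambda>\<phi> x. if x \<in> ?V then \<phi> x else x) ` isos G G \<subseteq> automorphisms G" by blast
  qed
qed

lemma compose_inverse:
  assumes "\<phi> \<in> isos G H"
  shows "compose (pverts G) (restrict (inv_into (pverts G) \<phi>) (pverts H)) \<phi> = (\<lambda>x\<in>pverts G. x)"
    and "compose (pverts H) \<phi> (restrict (inv_into (pverts G) \<phi>) (pverts H)) = (\<lambda>x\<in>pverts H. x)"
proof -
  have "bij_betw \<phi> (pverts G) (pverts H)" using assms by (simp add: isos_def)
  then show "compose (pverts G) (restrict (inv_into (pverts G) \<phi>) (pverts H)) \<phi> = (\<lambda>x\<in>pverts G. x)"
    and "compose (pverts H) \<phi> (restrict (inv_into (pverts G) \<phi>) (pverts H)) = (\<lambda>x\<in>pverts H. x)"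
    by (auto simp: compose_def fun_eq_iff bij_betw_inv_into_left bij_betw_inv_into_right bij_betw_apply)
qed

lemma isos_funcset: "\<phi> \<in> isos G H \<Longrightarrow> \<phi> \<in> pverts G \<rightarrow> pverts H"
  by (auto simp: isos_def bij_betw_def)

lemma isos_extensional: "\<phi> \<in> isos G H \<Longrightarrow> \<phi> \<in> extensional (pverts G)"
  by (simp add: isos_def)

text \<open>Composing with one fixed isomorphism \<open>\<phi>\<close> after an automorphism of
  \<open>G\<close> reaches every isomorphism exactly once.\<close>

lemma card_isos_source:
  assumes G: "pair_wf_digraph G" and H: "pair_wf_digraph H" and \<phi>: "\<phi> \<in> isos G H"
  shows "card (isos G H) = card (automorphisms G)"
proof -
  let ?\<psi> = "restrict (inv_into (pverts G) \<phi>) (pverts H)"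
  note \<psi> = inverse_isos[OF G \<phi>]
  have "bij_betw (compose (pverts G) \<phi>) (isos G G) (isos G H)"
  proof (rule bij_betw_byWitness[where f' = "compose (pverts G) ?\<psi>"])
    show "\<forall>\<chi>\<in>isos G G. compose (pverts G) ?\<psi> (compose (pverts G) \<phi> \<chi>) = \<chi>"
    proof
      fix \<chi> assume \<chi>: "\<chi> \<in> isos G G"
      show "compose (pverts G) ?\<psi> (compose (pverts G) \<phi> \<chi>) = \<chi>"
        unfolding compose_assoc[OF isos_funcset[OF \<chi>]] compose_inverse(1)[OF \<phi>]
        by (rule Id_compose[OF isos_funcset[OF \<chi>] isos_extensional[OF \<chi>]])
    qed
    show "\<forall>\<chi>\<in>isos G H. compose (pverts G) \<phi> (compose (pverts G) ?\<psi> \<chi>) = \<chi>"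
    proof
      fix \<chi> assume \<chi>: "\<chi> \<in> isos G H"
      show "compose (pverts G) \<phi> (compose (pverts G) ?\<psi> \<chi>) = \<chi>"
        unfolding compose_assoc[OF isos_funcset[OF \<chi>]] compose_inverse(2)[OF \<phi>]
        by (rule Id_compose[OF isos_funcset[OF \<chi>] isos_extensional[OF \<chi>]])
    qed
  qed (use compose_isos[OF G] \<phi> \<psi> in blast)+
  then show ?thesis using bij_betw_same_card card_isos_self[OF G] by metis
qed

text \<open>Here automorphisms of \<open>H\<close> are applied after \<open>\<phi>\<close>. The
  double count in \<open>card_isos_remove_arc\<close> uses both versions: one with the tree as
  source, one with the cycle as target.\<close>

lemma card_isos_target:
  assumes G: "pair_wf_digraph G" and H: "pair_wf_digraph H" and \<phi>: "\<phi> \<in> isos G H"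
  shows "card (isos G H) = card (automorphisms H)"
proof -
  let ?\<psi> = "restrict (inv_into (pverts G) \<phi>) (pverts H)"
  note \<psi> = inverse_isos[OF G \<phi>]
  have "bij_betw (\<lambda>\<chi>. compose (pverts G) \<chi> \<phi>) (isos H H) (isos G H)"
  proof (rule bij_betw_byWitness[where f' = "\<lambda>\<chi>. compose (pverts H) \<chi> ?\<psi>"])
    show "\<forall>\<chi>\<in>isos H H. compose (pverts H) (compose (pverts G) \<chi> \<phi>) ?\<psi> = \<chi>"
    proof
      fix \<chi> assume \<chi>: "\<chi> \<in> isos H H"
      show "compose (pverts H) (compose (pverts G) \<chi> \<phi>) ?\<psi> = \<chi>"
        unfolding compose_assoc[OF isos_funcset[OF \<psi>], symmetric] compose_inverse(2)[OF \<phi>]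
        by (rule compose_Id[OF isos_funcset[OF \<chi>] isos_extensional[OF \<chi>]])
    qed
    show "\<forall>\<chi>\<in>isos G H. compose (pverts G) (compose (pverts H) \<chi> ?\<psi>) \<phi> = \<chi>"
    proof
      fix \<chi> assume \<chi>: "\<chi> \<in> isos G H"
      show "compose (pverts G) (compose (pverts H) \<chi> ?\<psi>) \<phi> = \<chi>"
        unfolding compose_assoc[OF isos_funcset[OF \<phi>], symmetric] compose_inverse(1)[OF \<phi>]
        by (rule compose_Id[OF isos_funcset[OF \<chi>] isos_extensional[OF \<chi>]])
    qed
  qed (use compose_isos[OF H \<psi>] compose_isos[OF G \<phi>] in blast)+
  then show ?thesis using bij_betw_same_card card_isos_self[OF H] by metis
qed

lemma finite_isos: "finite (pverts G) \<Longrightarrow> finite (pverts H) \<Longrightarrow> finite (isos G H)"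
  by (rule finite_subset[OF _ finite_PiE, of _ "pverts G" "\<lambda>_. pverts H"])
    (auto simp: isos_def bij_betw_def PiE_def)

lemma card_automorphisms_pos:
  assumes "finite (pverts G)"
  shows "card (automorphisms G) > 0"
proof -
  have "id \<in> automorphisms G" by (simp add: automorphisms_def permutes_id map_prod.id)
  moreover have "finite (automorphisms G)"
    by (rule finite_subset[OF _ finite_permutations[OF assms]]) (auto simp: automorphisms_def)
  ultimately show ?thesis by (auto simp: card_gt_0_iff)
qed


section \<open>The divergence as a sum over the arcs of a cycle\<close>

definition remove_arc :: "nat pair_pre_digraph \<Rightarrow> nat \<times> nat \<Rightarrow> nat pair_pre_digraph" where
  "remove_arc C e = \<lparr>pverts = pverts C, parcs = parcs C - {e}\<rparr>"

lemma cycle_of_trees_ex1: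
  assumes "cycle_of_trees C" "v \<in> pverts C"
  shows "\<exists>!w. (v, w) \<in> parcs C"
proof -
  have "out_degree C v = 1" using assms by (simp add: cycle_of_trees_def)
  then show ?thesis by (simp only: out_degree_eq_1_iff)
qed

lemma cycle_of_trees_single_valued:
  assumes "cycle_of_trees C"
  shows "single_valued (parcs C)"
proof (rule single_valuedI)
  fix x y z assume xyz: "(x, y) \<in> parcs C" "(x, z) \<in> parcs C"
  then have "x \<in> pverts C"
    using pair_wf_digraph_subset[OF cycle_of_trees_imp_wf[OF assms]] by blast
  then show "y = z" using cycle_of_trees_ex1[OF assms] xyz by blast
qed

lemma isos_arcs_image:
  assumes "\<phi> \<in> isos G H"
  shows "map_prod \<phi> \<phi> ` parcs G = parcs H"
  using assms by (simp add: isos_def)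

text \<open>Both sides count the bijections that map the tree onto the cycle with one arc removed.\<close>

lemma card_isos_remove_arc:
  assumes C: "cycle_of_trees C"
  shows "card (automorphisms C) * card {v \<in> pverts (rep_rtree \<tau>). abs_tree_cycle (close_at (rep_rtree \<tau>) v) = abs_tree_cycle C}
    = symmetry \<tau> * card {e \<in> parcs C. rooted_tree (remove_arc C e) \<and> abs_rtree (remove_arc C e) = \<tau>}"
proof -
  let ?G = "rep_rtree \<tau>"
  let ?r = "root_of ?G"
  have G: "rooted_tree ?G" by (rule rooted_tree_rep)
  note F = rooted_tree_imp_rooted_forest[OF G]
  have wfG: "pair_wf_digraph ?G" and wfC: "pair_wf_digraph C"
    using G C rooted_tree_imp_wf cycle_of_trees_imp_wf by blast+
  note subG = pair_wf_digraph_subset[OF wfG] and subC = pair_wf_digraph_subset[OF wfC]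
  have finG: "finite (pverts ?G)" by (rule rooted_forestD(1)[OF F])
  have finC: "finite (pverts C)"
    using C pair_fin_digraph.pair_finite_verts by (auto simp: cycle_of_trees_def)
  have finA: "finite (parcs C)" by (rule finite_subset[OF subC]) (use finC in simp)
  have r: "?r \<in> pverts ?G" using rooted_forestD(6)[OF F] by blast
  have dom: "Domain (parcs ?G) = pverts ?G - {?r}"
    using rooted_forestD(2,5)[OF F] r by blast
  have svC: "single_valued (parcs C)" by (rule cycle_of_trees_single_valued[OF C])
  have domC: "Domain (parcs C) = pverts C"
    using cycle_of_trees_ex1[OF C] subC by blast
  \<comment> \<open>The first count splits \<open>\<Phi>\<close> by the removed arc; each nonempty
    part has \<open>symmetry \<tau>\<close> elements.\<close>
  define \<Phi> where "\<Phi> = {\<phi>. \<exists>e\<in>parcs C. \<phi> \<in> isos ?G (remove_arc C e)}"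
  define L where "L = {e \<in> parcs C. rooted_tree (remove_arc C e) \<and> abs_rtree (remove_arc C e) = \<tau>}"
  define W where "W = {v \<in> pverts ?G. abs_tree_cycle (close_at ?G v) = abs_tree_cycle C}"
  have verts_remove: "pverts (remove_arc C e) = pverts C" for e by (simp add: remove_arc_def)
  have in_L: "e \<in> L \<longleftrightarrow> e \<in> parcs C \<and> isos ?G (remove_arc C e) \<noteq> {}" for e
    unfolding L_def isos_nonempty_iff[OF wfG]
    using rooted_tree_iso[OF G] abs_rtree_eq_iff[OF G] abs_rep_rtree by auto
  have cyc: "cycle_of_trees (close_at ?G v)" if "v \<in> pverts ?G" for v
    by (rule cycle_of_trees_close_at[OF G that])
  have in_W: "v \<in> W \<longleftrightarrow> v \<in> pverts ?G \<and> isos (close_at ?G v) C \<noteq> {}" for v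
    unfolding W_def using abs_tree_cycle_eq_iff[OF cyc C] isos_nonempty_iff[OF cycle_of_trees_imp_wf[OF cyc]]
    by auto
  have verts_close: "pverts (close_at ?G v) = pverts ?G" for v by (simp add: close_at_def)
  have arcs_close: "parcs (close_at ?G v) = insert (?r, v) (parcs ?G)" for v by (simp add: close_at_def)
  have "\<Phi> = (\<Union>e\<in>L. isos ?G (remove_arc C e))" using in_L by (auto simp: \<Phi>_def)
  moreover have "card (isos ?G (remove_arc C e)) = symmetry \<tau>" if "e \<in> L" for e
  proof -
    have "rooted_tree (remove_arc C e)" using that by (simp add: L_def)
    then have "pair_wf_digraph (remove_arc C e)" by (rule rooted_tree_imp_wf)
    then show ?thesis
      using card_isos_source[OF wfG] that in_L unfolding symmetry_def by blast
  qed
  moreover have "e = e'" if "e \<in> L" "e' \<in> L" "\<phi> \<in> isos ?G (remove_arc C e)" "\<phi> \<in> isos ?G (remove_arc C e')"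
    for e e' \<phi>
  proof -
    have "parcs C - {e} = parcs C - {e'}"
      using that(3,4)[THEN isos_arcs_image] by (simp add: remove_arc_def)
    moreover have "e \<in> parcs C" "e' \<in> parcs C" using that by (simp_all add: L_def)
    ultimately show ?thesis by blast
  qed
  moreover have "finite L" using finA by (simp add: L_def)
  moreover have "finite (isos ?G (remove_arc C e))" for e
    by (rule finite_isos) (simp_all add: finG finC verts_remove)
  moreover have "card (\<Union>e\<in>L. isos ?G (remove_arc C e)) = (\<Sum>e\<in>L. card (isos ?G (remove_arc C e)))"
    by (rule card_UN_disjoint) (use calculation in blast)+
  ultimately have 1: "card \<Phi> = card L * symmetry \<tau>" by simp
  \<comment> \<open>The removed arc must start at the image of the root, the only vertex left
    without an outgoing arc, and it ends at some \<open>\<phi> v\<close>. Restoring it is the same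
    as closing the tree at \<open>v\<close>.\<close>
  have in_\<Phi>: "\<phi> \<in> \<Phi> \<longleftrightarrow> (\<exists>v\<in>pverts ?G. \<phi> \<in> isos (close_at ?G v) C)" for \<phi>
  proof
    assume "\<phi> \<in> \<Phi>"
    then obtain e where e: "e \<in> parcs C" "\<phi> \<in> isos ?G (remove_arc C e)" by (auto simp: \<Phi>_def)
    then have bij: "bij_betw \<phi> (pverts ?G) (pverts C)" and arcs: "map_prod \<phi> \<phi> ` parcs ?G = parcs C - {e}"
      by (simp_all add: isos_def remove_arc_def)
    obtain x y where xy: "e = (x, y)" by (cases e)
    have xy_im: "x \<in> \<phi> ` pverts ?G" "y \<in> \<phi> ` pverts ?G"
      using e(1) subC bij_betw_imp_surj_on[OF bij] by (auto simp: xy)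
    have "x \<notin> Domain (parcs C - {e})" using svC e(1) by (auto simp: xy single_valued_def)
    moreover have "\<phi> z \<in> Domain (parcs C - {e})" if "z \<in> pverts ?G" "z \<noteq> ?r" for z
    proof -
      have "z \<in> Domain (parcs ?G)" using that dom by simp
      then obtain w where "(z, w) \<in> parcs ?G" by blast
      then have "map_prod \<phi> \<phi> (z, w) \<in> parcs C - {e}" unfolding arcs[symmetric] by (rule imageI)
      then show ?thesis by auto
    qed
    moreover obtain u v where uv: "u \<in> pverts ?G" "v \<in> pverts ?G" "x = \<phi> u" "y = \<phi> v"
      using xy_im by blast
    ultimately have "u = ?r" by blast
    then have "parcs C = map_prod \<phi> \<phi> ` parcs (close_at ?G v)"
      using arcs e(1) uv by (auto simp: arcs_close xy)
    then have "\<phi> \<in> isos (close_at ?G v) C"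
      using e(2) bij by (simp add: isos_def verts_close)
    then show "\<exists>v\<in>pverts ?G. \<phi> \<in> isos (close_at ?G v) C" using uv by blast
  next
    assume "\<exists>v\<in>pverts ?G. \<phi> \<in> isos (close_at ?G v) C"
    then obtain v where v: "v \<in> pverts ?G" "\<phi> \<in> isos (close_at ?G v) C" by blast
    then have bij: "bij_betw \<phi> (pverts ?G) (pverts C)"
      and arcs: "insert (\<phi> ?r, \<phi> v) (map_prod \<phi> \<phi> ` parcs ?G) = parcs C"
      by (simp_all add: isos_def verts_close arcs_close)
    have "(\<phi> ?r, \<phi> v) \<notin> map_prod \<phi> \<phi> ` parcs ?G"
    proof
      assume "(\<phi> ?r, \<phi> v) \<in> map_prod \<phi> \<phi> ` parcs ?G"
      then obtain x y where xy: "(x, y) \<in> parcs ?G" "\<phi> ?r = \<phi> x" by auto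
      then have "x \<in> pverts ?G" using subG by blast
      then have "x = ?r" using xy(2) bij r by (auto simp: bij_betw_def dest: inj_onD)
      then show False using xy(1) dom by blast
    qed
    then have "map_prod \<phi> \<phi> ` parcs ?G = parcs C - {(\<phi> ?r, \<phi> v)}" using arcs by blast
    then have "\<phi> \<in> isos ?G (remove_arc C (\<phi> ?r, \<phi> v))"
      using v(2) bij by (simp add: isos_def remove_arc_def verts_close)
    then show "\<phi> \<in> \<Phi>" using arcs by (auto simp: \<Phi>_def)
  qed
  \<comment> \<open>The second count splits \<open>\<Phi>\<close> by the vertex \<open>v\<close> at
    which the tree is closed; each part has as many elements as \<open>C\<close> has
    automorphisms.\<close>
  have "\<Phi> = (\<Union>v\<in>W. isos (close_at ?G v) C)" using in_\<Phi> in_W by auto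
  moreover have "card (isos (close_at ?G v) C) = card (automorphisms C)" if "v \<in> W" for v
    using card_isos_target[OF cycle_of_trees_imp_wf[OF cyc] wfC] that in_W by blast
  moreover have "v = v'" if "v \<in> W" "v' \<in> W" "\<phi> \<in> isos (close_at ?G v) C" "\<phi> \<in> isos (close_at ?G v') C"
    for v v' \<phi>
  proof -
    have "(\<phi> ?r, \<phi> v) \<in> parcs C" "(\<phi> ?r, \<phi> v') \<in> parcs C"
      using that(3,4)[THEN isos_arcs_image] by (auto simp: arcs_close)
    then have "\<phi> v = \<phi> v'" using svC by (auto simp: single_valued_def)
    moreover have "inj_on \<phi> (pverts ?G)" using that(3) by (simp add: isos_def verts_close bij_betw_def)
    moreover have "v \<in> pverts ?G" "v' \<in> pverts ?G" using that(1,2) in_W by auto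
    ultimately show ?thesis by (auto dest: inj_onD)
  qed
  moreover have "finite W" using finG by (simp add: W_def)
  moreover have "finite (isos (close_at ?G v) C)" for v
    by (rule finite_isos) (simp_all add: finG finC verts_close)
  moreover have "card (\<Union>v\<in>W. isos (close_at ?G v) C) = (\<Sum>v\<in>W. card (isos (close_at ?G v) C))"
    by (rule card_UN_disjoint) (use calculation in blast)+
  ultimately have 2: "card \<Phi> = card W * card (automorphisms C)" by simp
  show ?thesis using 1 2 unfolding L_def W_def by (simp add: mult.commute)
qed

text \<open>By \<open>card_isos_remove_arc\<close> each tree contributes its coefficient times its
  symmetry once for every arc whose removal yields it. Summing over the trees groups the arcs by the
  resulting tree.\<close>

lemma divergence_cycle:
  assumes C: "cycle_of_trees C"
  shows "real (card (automorphisms C)) * divergence p (abs_tree_cycle C) =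
    (\<Sum>e | e \<in> parcs C \<and> rooted_tree (remove_arc C e).
      p (abs_rtree (remove_arc C e)) * real (symmetry (abs_rtree (remove_arc C e))))"
proof -
  let ?n = "card (pverts C)" and ?K = "card (automorphisms C)"
  let ?L = "{e. e \<in> parcs C \<and> rooted_tree (remove_arc C e)}"
  let ?g = "\<lambda>e. abs_rtree (remove_arc C e)"
  have wfC: "pair_wf_digraph C" by (rule cycle_of_trees_imp_wf[OF C])
  have finC: "finite (pverts C)"
    using C pair_fin_digraph.pair_finite_verts by (auto simp: cycle_of_trees_def)
  have finA: "finite (parcs C)"
    by (rule finite_subset[OF pair_wf_digraph_subset[OF wfC]]) (use finC in simp)
  have g: "?g ` ?L \<subseteq> {\<tau>. num_vertices \<tau> = ?n}"
    by (auto simp: num_vertices_abs) (simp add: remove_arc_def)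
  have summand: "real ?K * (p \<tau> * tree_divergence \<tau> (abs_tree_cycle C))
      = (\<Sum>e | e \<in> ?L \<and> ?g e = \<tau>. p (?g e) * real (symmetry (?g e)))" for \<tau>
  proof -
    have "real ?K * tree_divergence \<tau> (abs_tree_cycle C)
        = real (symmetry \<tau>) * real (card {e \<in> parcs C. rooted_tree (remove_arc C e) \<and> ?g e = \<tau>})"
      unfolding tree_divergence_def of_nat_mult[symmetric] card_isos_remove_arc[OF C] ..
    moreover have "{e. e \<in> ?L \<and> ?g e = \<tau>} = {e \<in> parcs C. rooted_tree (remove_arc C e) \<and> ?g e = \<tau>}"
      by auto
    moreover have "(\<Sum>e | e \<in> ?L \<and> ?g e = \<tau>. p (?g e) * real (symmetry (?g e)))
        = (\<Sum>e | e \<in> ?L \<and> ?g e = \<tau>. p \<tau> * real (symmetry \<tau>))"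
      by (rule sum.cong) auto
    ultimately show ?thesis by simp
  qed
  have "real ?K * divergence p (abs_tree_cycle C)
      = (\<Sum>\<tau> | num_vertices \<tau> = ?n. real ?K * (p \<tau> * tree_divergence \<tau> (abs_tree_cycle C)))"
    by (simp add: divergence_def cycle_num_vertices_abs[OF C] sum_distrib_left)
  also have "\<dots> = (\<Sum>\<tau> | num_vertices \<tau> = ?n. \<Sum>e | e \<in> ?L \<and> ?g e = \<tau>. p (?g e) * real (symmetry (?g e)))"
    by (rule sum.cong[OF refl summand])
  also have "\<dots> = (\<Sum>e\<in>?L. p (?g e) * real (symmetry (?g e)))"
    using finA finite_num_vertices g by (intro sum.group) auto
  finally show ?thesis by simp
qed

section \<open>From volume preservation to vanishing cycle sums\<close>

lemma symmetry_pos: "symmetry \<tau> > 0"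
  unfolding symmetry_def
  by (rule card_automorphisms_pos)
    (rule rooted_forestD(1)[OF rooted_tree_imp_rooted_forest[OF rooted_tree_rep]])

lemma rooted_tree_of_rooted_forest:
  "rooted_forest V {r} F \<Longrightarrow> rooted_tree \<lparr>pverts = V, parcs = F\<rparr>"
  by (rule rooted_forest_imp_rooted_tree) simp

text \<open>A tree has no loop and \<open>v\<close> differs from its root, so closing it at
  \<open>v\<close> gives a loopless cycle, whose divergence coefficient must vanish. By
  \<open>divergence_cycle\<close> this is the required sum over arcs.\<close>

lemma volume_preserving_cycle_sum_zero:
  assumes p: "volume_preserving p"
  shows "cycle_sum_zero (\<lambda>V F. p (abs_rtree \<lparr>pverts = V, parcs = F\<rparr>)
    * real (symmetry (abs_rtree \<lparr>pverts = V, parcs = F\<rparr>)))"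
proof
  fix V r and F :: "nat rel" and \<phi> :: "nat \<Rightarrow> nat"
  assume F: "rooted_forest V {r} F" and \<phi>: "inj_on \<phi> V"
  let ?G = "\<lparr>pverts = V, parcs = F\<rparr>" and ?H = "\<lparr>pverts = \<phi> ` V, parcs = map_prod \<phi> \<phi> ` F\<rparr>"
  have G: "rooted_tree ?G" by (rule rooted_tree_of_rooted_forest[OF F])
  have "digraph_iso ?G ?H"
    unfolding digraph_iso_pair_iff[OF rooted_tree_imp_wf[OF G]] using \<phi> by auto
  then have "abs_rtree ?G = abs_rtree ?H" by (rule abs_rtree_eqI[OF G])
  then show "p (abs_rtree ?H) * real (symmetry (abs_rtree ?H)) = p (abs_rtree ?G) * real (symmetry (abs_rtree ?G))"
    by simp
next
  fix V r v and F :: "nat rel"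
  assume F: "rooted_forest V {r} F" and v: "v \<in> V" "v \<noteq> r"
  let ?G = "\<lparr>pverts = V, parcs = F\<rparr>"
  let ?C = "close_at ?G v"
  have G: "rooted_tree ?G" by (rule rooted_tree_of_rooted_forest[OF F])
  have root: "root_of ?G = r" by (rule root_of_rooted_forest) (simp add: F)
  have C: "cycle_of_trees ?C" by (rule cycle_of_trees_close_at[OF G]) (simp add: v)
  have pC: "pverts ?C = V" "parcs ?C = insert (r, v) F" by (simp_all add: close_at_def root)
  have "\<not> has_loop (abs_tree_cycle ?C)"
    unfolding has_loop_abs[OF C] pC using v rooted_forest_not_loop[OF F] by auto
  then have "divergence p (abs_tree_cycle ?C) = 0"
    using fun_cong[OF p[unfolded volume_preserving_def], of "abs_tree_cycle ?C"]
    by (simp add: reduced_divergence_def)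
  moreover have rem: "remove_arc ?C e = \<lparr>pverts = V, parcs = insert (r, v) F - {e}\<rparr>" for e
    by (simp add: remove_arc_def pC)
  moreover have "rooted_tree \<lparr>pverts = V, parcs = insert (r, v) F - {e}\<rparr>
      \<longleftrightarrow> (\<exists>s. rooted_forest V {s} (insert (r, v) F - {e}))" for e
    using rooted_tree_imp_rooted_forest[of "\<lparr>pverts = V, parcs = insert (r, v) F - {e}\<rparr>"]
      rooted_tree_of_rooted_forest by auto
  ultimately show "(\<Sum>e | e \<in> insert (r, v) F \<and> (\<exists>s. rooted_forest V {s} (insert (r, v) F - {e})).
      p (abs_rtree \<lparr>pverts = V, parcs = insert (r, v) F - {e}\<rparr>)
        * real (symmetry (abs_rtree \<lparr>pverts = V, parcs = insert (r, v) F - {e}\<rparr>))) = 0"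
    using divergence_cycle[OF C, of p] unfolding rem pC by simp
qed

lemma volume_preserving_vanish:
  assumes p: "volume_preserving p" and n: "2 \<le> num_vertices \<tau>"
  shows "p \<tau> = 0"
proof -
  interpret cycle_sum_zero "\<lambda>V F. p (abs_rtree \<lparr>pverts = V, parcs = F\<rparr>)
    * real (symmetry (abs_rtree \<lparr>pverts = V, parcs = F\<rparr>))"
    by (rule volume_preserving_cycle_sum_zero[OF p])
  have rep: "\<lparr>pverts = pverts (rep_rtree \<tau>), parcs = parcs (rep_rtree \<tau>)\<rparr> = rep_rtree \<tau>" by simp
  have "p \<tau> * real (symmetry \<tau>) = 0"
    using cycle_sum_zero_vanish[OF infinite_UNIV_nat rooted_tree_imp_rooted_forest[OF rooted_tree_rep[of \<tau>]]] n
    unfolding num_vertices_def rep abs_rep_rtree by simp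
  then show ?thesis using symmetry_pos[of \<tau>] by simp
qed


section \<open>The tree with one vertex\<close>

lemma num_vertices_pos: "num_vertices \<tau> > 0"
proof -
  note F = rooted_tree_imp_rooted_forest[OF rooted_tree_rep[of \<tau>]]
  then show ?thesis
    using rooted_forestD(1,6)[OF F] by (auto simp: num_vertices_def card_gt_0_iff)
qed

lemma num_vertices_bullet: "num_vertices bullet = 1"
  unfolding bullet_def by (simp add: num_vertices_abs rooted_tree_single_vertex) (simp add: single_vertex_def)

lemma rep_rtree_one_vertex:
  assumes "num_vertices \<tau> = 1"
  obtains x where "pverts (rep_rtree \<tau>) = {x}" "parcs (rep_rtree \<tau>) = {}" "root_of (rep_rtree \<tau>) = x"
proof -
  note F = rooted_tree_imp_rooted_forest[OF rooted_tree_rep[of \<tau>]]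
  obtain x where x: "pverts (rep_rtree \<tau>) = {x}"
    using assms by (auto simp: num_vertices_def card_1_singleton_iff)
  moreover have "parcs (rep_rtree \<tau>) = {}"
    using rooted_forestD(2)[OF F] rooted_forest_not_loop[OF F] x by auto
  moreover have "root_of (rep_rtree \<tau>) = x"
    using rooted_forestD(6)[OF F] x by simp
  ultimately show thesis using that by blast
qed

lemma num_vertices_eq_1_iff: "num_vertices \<tau> = 1 \<longleftrightarrow> \<tau> = bullet"
proof
  assume "num_vertices \<tau> = 1"
  then obtain x where x: "pverts (rep_rtree \<tau>) = {x}" "parcs (rep_rtree \<tau>) = {}"
    by (rule rep_rtree_one_vertex)
  have "digraph_iso (rep_rtree \<tau>) single_vertex"
    unfolding digraph_iso_pair_iff[OF rooted_tree_imp_wf[OF rooted_tree_rep]]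
    by (rule exI[of _ "\<lambda>_. 0"]) (simp add: x single_vertex_def)
  then show "\<tau> = bullet"
    using abs_rtree_eqI[OF rooted_tree_rep] unfolding bullet_def abs_rep_rtree by blast
qed (simp add: num_vertices_bullet)

lemma symmetry_bullet: "symmetry bullet = 1"
proof -
  obtain x where x: "pverts (rep_rtree bullet) = {x}" "parcs (rep_rtree bullet) = {}"
    by (rule rep_rtree_one_vertex[OF num_vertices_bullet])
  have "automorphisms (rep_rtree bullet) = {id}"
    unfolding automorphisms_def x by (auto simp: permutes_sing)
  then show ?thesis by (simp add: symmetry_def)
qed

text \<open>The only way of closing the one-vertex tree produces a loop, and cycles with a loop are
  discarded.\<close>

lemma volume_preserving_f_series: "volume_preserving (\<lambda>\<tau>. c * f_series \<tau>)"
  unfolding volume_preserving_def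
proof
  fix \<gamma>
  obtain x where x: "pverts (rep_rtree bullet) = {x}" "root_of (rep_rtree bullet) = x"
    by (rule rep_rtree_one_vertex[OF num_vertices_bullet])
  have "tree_divergence bullet \<gamma> = 0" if "\<not> has_loop \<gamma>"
  proof -
    have "abs_tree_cycle (close_at (rep_rtree bullet) x) \<noteq> \<gamma>"
    proof
      assume *: "abs_tree_cycle (close_at (rep_rtree bullet) x) = \<gamma>"
      have "cycle_of_trees (close_at (rep_rtree bullet) x)"
        by (rule cycle_of_trees_close_at[OF rooted_tree_rep]) (simp add: x)
      then have "has_loop \<gamma>"
        unfolding *[symmetric] using has_loop_abs by (auto simp: close_at_def x)
      then show False using that by blast
    qed
    then have "{v \<in> pverts (rep_rtree bullet). abs_tree_cycle (close_at (rep_rtree bullet) v) = \<gamma>} = {}"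
      using x by auto
    then show ?thesis unfolding tree_divergence_def by (simp only: card.empty of_nat_0)
  qed
  then have "\<not> has_loop \<gamma> \<Longrightarrow> divergence (\<lambda>\<tau>. c * f_series \<tau>) \<gamma> = 0"
    unfolding divergence_def by (intro sum.neutral) (auto simp: f_series_def)
  then show "reduced_divergence (\<lambda>\<tau>. c * f_series \<tau>) \<gamma> = 0"
    by (simp add: reduced_divergence_def)
qed

lemma volume_preserving_iff: "volume_preserving p \<longleftrightarrow> p = (\<lambda>\<tau>. p bullet * f_series \<tau>)"
proof
  assume p: "volume_preserving p"
  show "p = (\<lambda>\<tau>. p bullet * f_series \<tau>)"
  proof
    fix \<tau>
    have "2 \<le> num_vertices \<tau>" if "\<tau> \<noteq> bullet"
      using that num_vertices_pos[of \<tau>] num_vertices_eq_1_iff[of \<tau>] by linarith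
    then show "p \<tau> = p bullet * f_series \<tau>"
      using volume_preserving_vanish[OF p] by (cases "\<tau> = bullet") (auto simp: f_series_def)
  qed
next
  assume "p = (\<lambda>\<tau>. p bullet * f_series \<tau>)"
  then show "volume_preserving p" using volume_preserving_f_series by metis
qed


section \<open>The exact flow determines the vector field\<close>

text \<open>Both trees taking part in a grafting have at least one vertex, hence each is strictly
  smaller than the result.\<close>

lemma derivative_along_cong:
  assumes "\<And>\<tau>. num_vertices \<tau> < num_vertices \<theta> \<Longrightarrow> p \<tau> = p' \<tau> \<and> q \<tau> = q' \<tau>"
  shows "derivative_along p q \<theta> = derivative_along p' q' \<theta>"
  unfolding derivative_along_def
proof (rule sum.cong[OF refl], clarify)
  fix \<rho> \<tau> assume "num_vertices \<rho> + num_vertices \<tau> = num_vertices \<theta>"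
  then have "num_vertices \<rho> < num_vertices \<theta>" "num_vertices \<tau> < num_vertices \<theta>"
    using num_vertices_pos[of \<rho>] num_vertices_pos[of \<tau>] by linarith+
  then show "p \<rho> * q \<tau> * graft_coeff \<rho> \<tau> \<theta> = p' \<rho> * q' \<tau> * graft_coeff \<rho> \<tau> \<theta>"
    using assms by simp
qed

lemma derivative_along_iterate_cong:
  assumes "\<And>\<tau>. num_vertices \<tau> < n \<Longrightarrow> p \<tau> = p' \<tau>" and "num_vertices \<theta> < n"
  shows "(derivative_along p ^^ k) p \<theta> = (derivative_along p' ^^ k) p' \<theta>"
  using assms(2)
proof (induction k arbitrary: \<theta>)
  case 0
  then show ?case using assms(1) by simp
next
  case (Suc k)
  have "derivative_along p ((derivative_along p ^^ k) p) \<theta>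
      = derivative_along p' ((derivative_along p' ^^ k) p') \<theta>"
    by (rule derivative_along_cong) (use Suc assms(1) in auto)
  then show ?case by simp
qed

text \<open>In the coefficient of \<open>\<theta>\<close> the value \<open>p \<theta>\<close> enters
  only through the linear term \<open>t * p \<theta>\<close>; the higher derivatives involve smaller
  trees. Induction on the size recovers \<open>p\<close>.\<close>

lemma exact_increment_inject:
  assumes "t \<noteq> 0" and eq: "exact_increment t p = exact_increment t p'"
  shows "p = p'"
proof
  fix \<theta>
  show "p \<theta> = p' \<theta>"
  proof (induction "num_vertices \<theta>" arbitrary: \<theta> rule: less_induct)
    case less
    let ?n = "num_vertices \<theta>"
    have "(derivative_along p ^^ (k - 1)) p \<theta> = (derivative_along p' ^^ (k - 1)) p' \<theta>"
      if k: "k \<in> {Suc 1..?n}" for k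
    proof -
      obtain j where j: "k - 1 = Suc j" using k by (cases "k - 1") auto
      have "derivative_along p ((derivative_along p ^^ j) p) \<theta>
          = derivative_along p' ((derivative_along p' ^^ j) p') \<theta>"
        by (rule derivative_along_cong)
          (use less derivative_along_iterate_cong[of ?n p p'] in blast)
      then show ?thesis unfolding j by simp
    qed
    then have "(\<Sum>k = Suc 1..?n. t ^ k / fact k * (derivative_along p ^^ (k - 1)) p \<theta>)
        = (\<Sum>k = Suc 1..?n. t ^ k / fact k * (derivative_along p' ^^ (k - 1)) p' \<theta>)"
      by (intro sum.cong) auto
    moreover have "1 \<le> ?n" using num_vertices_pos[of \<theta>] by simp
    then have "exact_increment t q \<theta>
        = t * q \<theta> + (\<Sum>k = Suc 1..?n. t ^ k / fact k * (derivative_along q ^^ (k - 1)) q \<theta>)" for q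
      unfolding exact_increment_def by (subst sum.atLeast_Suc_atMost) auto
    ultimately show ?case using fun_cong[OF eq, of \<theta>] \<open>t \<noteq> 0\<close> by simp
  qed
qed

text \<open>For a single vertex the Taylor sum consists of \<open>k = 1\<close> alone, and both
  sides carry one factor \<open>h\<close>.\<close>

lemma modified_field_bullet:
  assumes "h \<noteq> 0" "modified_coeffs h a b"
  shows "modified_field h b bullet = a bullet"
proof -
  have "bseries_increment h a bullet = exact_increment h (modified_field h b) bullet"
    using assms(2) unfolding modified_coeffs_def by (rule fun_cong)
  then show ?thesis
    using assms(1)
    by (simp add: bseries_increment_def exact_increment_def num_vertices_bullet symmetry_bullet)
qed

text \<open>Without consistency the modified field is a multiple of \<open>f\<close>, which means
  the exact flow with rescaled time. Consistency makes the factor one, and the last equivalence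
  states the result for the numerical step itself.\<close>

theorem proposition5p3:
  fixes h :: real and a b :: "rtree \<Rightarrow> real"
  assumes step: "h \<noteq> 0"
    and backward_error: "modified_coeffs h a b"
  shows "(volume_preserving (modified_field h b) \<longleftrightarrow>
            modified_field h b = (\<lambda>\<tau>. a bullet * f_series \<tau>)) \<and>
         (consistent a \<longrightarrow>
            (volume_preserving (modified_field h b) \<longleftrightarrow> modified_field h b = f_series) \<and>
            (volume_preserving (modified_field h b) \<longleftrightarrow>
               bseries_increment h a = exact_increment h f_series))"
proof -
  have 1: "volume_preserving (modified_field h b) \<longleftrightarrow>
      modified_field h b = (\<lambda>\<tau>. a bullet * f_series \<tau>)"
    using volume_preserving_iff[of "modified_field h b"] modified_field_bullet[OF assms] by simp
  \<comment> \<open>The numerical step is the exact step of the modified field, and by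
    \<open>exact_increment_inject\<close> equal steps mean equal fields.\<close>
  moreover have "bseries_increment h a = exact_increment h f_series \<longleftrightarrow> modified_field h b = f_series"
    using backward_error exact_increment_inject[OF step] unfolding modified_coeffs_def by metis
  ultimately show ?thesis by (simp add: consistent_def)
qed

end
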